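(* Let $X,U,Y$ be Banach lattices, let $p\in[1,\infty)$, and let $(A,B,C)$ be a positive $L^p$-well-posed triplet on $(X,U,Y)$. Then the following assertions are equivalent: (i) $(A,B,C)$ is a positive $L^p$-well-posed strongly regular triplet; (ii) $(A,B,C)$ is a positive $L^p$-well-posed weakly regular triplet. In this case, the feedthrough operator $D$ is positive.
   Context: Setting. $A$ generates a $C_0$-semigroup $\mathbb{T}=(T(t))_{t\ge0}$ on $X$; $X_1$ is $D(A)$ with the norm $\Vert(\mu I-A)x\Vert$, and $X_{-1}$ is the completion of $X$ for $\Vert R(\mu,A)x\Vert$ ($\mu\in\rho(A)$); $\mathbb{T}_{-1}$ is the unique extension of $\mathbb{T}$ to a $C_0$-semigroup on $X_{-1}$, with generator $A_{-1}$; $X_{-1,+}$ is the closure of $X_+$ in $X_{-1}$. Let $B\in\mathcal{L}(U,X_{-1})$ and $\Phi_tu=\int_0^tT_{-1}(t-s)Bu(s)\,ds$. $B$ is an $L^p$-admissible control operator for $A$ if for some $\tau>0$, $\Phi_\tau u\in X$ for all $u\in L^p(\mathbb{R}_+;U)$. Put $Z=X_1+R(\mu,A_{-1})BU$ ($\mu\in\rho(A)$; independent of $\mu$), a Banach space with norm $\Vert z\Vert_Z^2=\inf\{\Vert x\Vert_{X_1}^2+\Vert u\Vert_U^2: z=x+R(\mu,A_{-1})Bu,\ x\in X_1,\ u\in U\}$. Let $\Gamma\in\mathcal{L}(Z,Y)$, $D_\Sigma\in\mathcal{L}(U,Y)$ and $C:=\Gamma_{|D(A)}$. $C$ is an $L^p$-admissible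 observation operator for $A$ if for some (all) $\alpha>0$ there is $\gamma>0$ with $\int_0^\alpha\Vert CT(t)x\Vert^pdt\le\gamma^p\Vert x\Vert^p$ for all $x\in D(A)$. For $u\in W^{1,p}_0([0,\tau];U)=\{u\in W^{1,p}([0,\tau];U):u(0)=0\}$ one has $\Phi_tu\in Z$ and one defines $(\mathbb{F}u)(t)=\Gamma\Phi_tu+D_\Sigma u(t)$. $(A,B,C)$ is an $L^p$-well-posed triplet on $(X,U,Y)$ if $B$ is an $L^p$-admissible control operator for $A$, $C$ is an $L^p$-admissible observation operator for $A$, and for every $\tau>0$ there is $\beta>0$ with $\Vert\mathbb{F}u\Vert_{L^p([0,\tau];Y)}\le\beta\Vert u\Vert_{L^p([0,\tau];U)}$ for all $u\in W^{1,p}_0([0,\tau];U)$; then $\mathbb{F}$ extends uniquely by continuity to the input-output map $\mathbb{F}:L^p_{loc}(\mathbb{R}_+;U)\to L^p_{loc}(\mathbb{R}_+;Y)$. The triplet is positive if $\mathbb{T}$, $B$ (i.e. $BU_+\subset X_{-1,+}$), $C$ (i.e. $Cx\in Y_+$ for $x\in D(A)\cap X_+$) and $\mathbb{F}$ (a.e. pointwise order) are positive; equivalently, positive initial states and positive inputs produce positive states and outputs in the system $\dot z=A_{-1}z+Bu$, $y=\Gamma z+D_\Sigma u$. Transfer function and regularity. The transfer function $\mathbf{H}$ is the $\mathcal{L}(U,Y)$-valued analytic function with $\widehat{\mathbb{F}u}(\mu)=\mathbf{H}(\mu)\hat u(\mu)$ (Laplace transforms) on some right half-plane; explicitly $\mathbf{H}(\mu)=\Gamma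 R(\mu,A_{-1})B+D_\Sigma$ for $\mu\in\rho(A)$. The triplet is strongly (resp. weakly) regular if the limit $Du:=\lim_{\mathbb{R}\ni\mu\to+\infty}\mathbf{H}(\mu)u$ exists for every $u\in U$ in the norm (resp. weak) topology of $Y$; $D\in\mathcal{L}(U,Y)$ is called the feedthrough operator. *)

theory Defs
  imports "HOL-Analysis.Analysis" "HOL-Library.Lattice_Algebras"
begin

section \<open>Banach lattices\<close>

class banach_lattice = banach + ordered_real_vector + lattice_ab_group_add_abs +
  assumes norm_mono_abs: "\<bar>x\<bar> \<le> \<bar>y\<bar> \<Longrightarrow> norm x \<le> norm y"

instance real :: banach_lattice
  by standard (auto simp: sup_real_def)


section \<open>Semigroups, generators and resolvents\<close>

definition C0_semigroup :: "(real \<Rightarrow> 'a::banach \<Rightarrow>\<^sub>L 'a) \<Rightarrow> bool" where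
  "C0_semigroup T \<longleftrightarrow>
     T 0 = id_blinfun \<and>
     (\<forall>s\<ge>0. \<forall>t\<ge>0. T (s + t) = T s o\<^sub>L T t) \<and>
     (\<forall>x. ((\<lambda>t. T t x) \<longlongrightarrow> x) (at_right 0))"

text \<open>An unbounded operator is represented by its graph, so its domain is \<^const>\<open>Domain\<close>.\<close>

definition generator :: "(real \<Rightarrow> 'a::banach \<Rightarrow>\<^sub>L 'a) \<Rightarrow> ('a \<times> 'a) set" where
  "generator T = {(x, y). ((\<lambda>h. (T h x - x) /\<^sub>R h) \<longlongrightarrow> y) (at_right 0)}"

text \<open>\<open>R\<close> is a bounded two-sided inverse of \<open>\<mu>I - A\<close>; such an \<open>R\<close> is unique.\<close>

definition is_resolvent :: "real \<Rightarrow> ('a::banach \<times> 'a) set \<Rightarrow> ('a \<Rightarrow>\<^sub>L 'a) \<Rightarrow> bool" where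
  "is_resolvent \<mu> A R \<longleftrightarrow>
     (\<forall>z. (R z, \<mu> *\<^sub>R R z - z) \<in> A) \<and> (\<forall>(x, y)\<in>A. R (\<mu> *\<^sub>R x - y) = x)"

definition resolvent_set :: "('a::banach \<times> 'a) set \<Rightarrow> real set" where
  "resolvent_set A = {\<mu>. \<exists>R. is_resolvent \<mu> A R}"

definition resolvent :: "real \<Rightarrow> ('a::banach \<times> 'a) set \<Rightarrow> 'a \<Rightarrow>\<^sub>L 'a" where
  "resolvent \<mu> A = (THE R. is_resolvent \<mu> A R)"


section \<open>The extrapolation space\<close>

text \<open>
  The completion \<open>X\<^sub>-\<^sub>1\<close> of \<open>X\<close> for the norm \<open>\<parallel>R(\<mu>,A)x\<parallel>\<close> is given by its defining property: a
  Banach space (the type \<open>'e\<close>) with a linear map \<open>j\<close> of \<open>X\<close> onto a dense subspace that is isometric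
  for that norm. This determines \<open>X\<^sub>-\<^sub>1\<close> up to an isometric isomorphism fixing \<open>X\<close>. The inclusion of
  \<open>X\<close> in \<open>X\<^sub>-\<^sub>1\<close> is written out as \<open>j\<close> throughout; an element of \<open>X\<^sub>-\<^sub>1\<close> lies in \<open>X\<close> if it is in
  \<open>range j\<close>.
\<close>

definition extrapolation_space ::
  "('x::banach \<times> 'x) set \<Rightarrow> real \<Rightarrow> ('x \<Rightarrow> 'e::banach) \<Rightarrow> bool" where
  "extrapolation_space A \<mu> j \<longleftrightarrow>
     \<mu> \<in> resolvent_set A \<and> linear j \<and>
     (\<forall>x. norm (j x) = norm (resolvent \<mu> A x)) \<and> closure (range j) = UNIV"

definition extends_semigroup ::
  "('x::banach \<Rightarrow> 'e::banach) \<Rightarrow> (real \<Rightarrow> 'x \<Rightarrow>\<^sub>L 'x) \<Rightarrow> (real \<Rightarrow> 'e \<Rightarrow>\<^sub>L 'e) \<Rightarrow> bool" where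
  "extends_semigroup j T S \<longleftrightarrow> C0_semigroup S \<and> (\<forall>t\<ge>0. \<forall>x. S t (j x) = j (T t x))"

definition extrapolated_cone :: "('x::banach_lattice \<Rightarrow> 'e::banach) \<Rightarrow> 'e set" where
  "extrapolated_cone j = closure (j ` {x. 0 \<le> x})"


section \<open>Vector-valued function spaces\<close>

text \<open>
  The library's Bochner integral and Borel measurability are suited to second countable ranges only,
  and the spaces here need not be separable. Hence measurability is strong measurability, and
  vector-valued integrals are taken as the Henstock--Kurzweil \<^const>\<open>integral\<close>, which is available
  for every Banach space. It is only applied to functions which are Bochner integrable (products of
  strongly continuous operator families with \<open>L\<^sup>p\<close> functions on bounded intervals), and for these the
  two integrals exist and agree.
\<close>

definition strongly_measurable :: "'a measure \<Rightarrow> ('a \<Rightarrow> 'b::banach) \<Rightarrow> bool" where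
  "strongly_measurable M f \<longleftrightarrow>
     (\<exists>s. (\<forall>i::nat. simple_function M (s i)) \<and> (AE x in M. (\<lambda>i. s i x) \<longlonglongrightarrow> f x))"

text \<open>The \<open>p\<close>-th power of the norm of \<open>L\<^sup>p(S)\<close>.\<close>

definition Lp_norm_pow :: "real \<Rightarrow> real set \<Rightarrow> (real \<Rightarrow> 'b::banach) \<Rightarrow> ennreal" where
  "Lp_norm_pow p S f = (\<integral>\<^sup>+t. ennreal (norm (f t) powr p) \<partial>lebesgue_on S)"

definition Lp :: "real \<Rightarrow> real set \<Rightarrow> (real \<Rightarrow> 'b::banach) set" where
  "Lp p S = {f. strongly_measurable (lebesgue_on S) f \<and> Lp_norm_pow p S f < \<infinity>}"

definition Lp_loc :: "real \<Rightarrow> (real \<Rightarrow> 'b::banach) set" where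
  "Lp_loc p = (\<Inter>\<tau>\<in>{0<..}. Lp p {0..\<tau>})"

definition Lp_tendsto ::
  "real \<Rightarrow> real set \<Rightarrow> (nat \<Rightarrow> real \<Rightarrow> 'b::banach) \<Rightarrow> (real \<Rightarrow> 'b) \<Rightarrow> bool" where
  "Lp_tendsto p S f g \<longleftrightarrow> (\<lambda>n. Lp_norm_pow p S (\<lambda>t. f n t - g t)) \<longlonglongrightarrow> 0"

text \<open>
  \<open>W\<^sup>1\<^sup>,\<^sup>p([0,\<tau>])\<close> consists of the primitives of \<open>L\<^sup>p\<close> functions; elements are identified with their
  continuous representatives, which makes the condition \<open>u(0) = 0\<close> meaningful.
\<close>

definition W1p :: "real \<Rightarrow> real \<Rightarrow> (real \<Rightarrow> 'b::banach) set" where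
  "W1p p \<tau> = {u. \<exists>v\<in>Lp p {0..\<tau>}. \<forall>t\<in>{0..\<tau>}. u t = u 0 + integral {0..t} v}"

definition W1p_0 :: "real \<Rightarrow> real \<Rightarrow> (real \<Rightarrow> 'b::banach) set" where
  "W1p_0 p \<tau> = {u \<in> W1p p \<tau>. u 0 = 0}"


section \<open>Admissible operators\<close>

text \<open>From here on \<open>S\<close> is the extended semigroup \<open>\<T>\<^sub>-\<^sub>1\<close> on \<open>X\<^sub>-\<^sub>1\<close> and \<open>Am\<close> is its generator \<open>A\<^sub>-\<^sub>1\<close>.\<close>

definition input_map ::
  "(real \<Rightarrow> 'e::banach \<Rightarrow>\<^sub>L 'e) \<Rightarrow> ('u::banach \<Rightarrow>\<^sub>L 'e) \<Rightarrow> real \<Rightarrow> (real \<Rightarrow> 'u) \<Rightarrow> 'e" where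
  "input_map S B t u = integral {0..t} (\<lambda>s. S (t - s) (B (u s)))"

definition control_admissible ::
  "real \<Rightarrow> ('x::banach \<Rightarrow> 'e::banach) \<Rightarrow> (real \<Rightarrow> 'e \<Rightarrow>\<^sub>L 'e) \<Rightarrow> ('u::banach \<Rightarrow>\<^sub>L 'e) \<Rightarrow> bool" where
  "control_admissible p j S B \<longleftrightarrow> (\<exists>\<tau>>0. \<forall>u\<in>Lp p {0..}. input_map S B \<tau> u \<in> range j)"

definition observation_admissible ::
  "real \<Rightarrow> (real \<Rightarrow> 'x::banach \<Rightarrow>\<^sub>L 'x) \<Rightarrow> ('x \<times> 'x) set \<Rightarrow> ('x \<Rightarrow> 'y::banach) \<Rightarrow> bool" where
  "observation_admissible p T A C \<longleftrightarrow>
     (\<exists>\<alpha>>0. \<exists>\<gamma>>0. \<forall>x\<in>Domain A.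
        Lp_norm_pow p {0..\<alpha>} (\<lambda>t. C (T t x)) \<le> ennreal (\<gamma> powr p * norm x powr p))"


section \<open>The space Z\<close>

definition Z_space ::
  "real \<Rightarrow> ('x::banach \<times> 'x) set \<Rightarrow> ('x \<Rightarrow> 'e::banach) \<Rightarrow> ('e \<times> 'e) set \<Rightarrow> ('u::banach \<Rightarrow>\<^sub>L 'e)
     \<Rightarrow> 'e set" where
  "Z_space \<mu> A j Am B = {j x + resolvent \<mu> Am (B u) | x u. x \<in> Domain A}"

text \<open>For \<open>(x, y) \<in> A\<close> the norm of \<open>x\<close> in \<open>X\<^sub>1\<close> is \<open>\<parallel>\<mu>x - y\<parallel>\<close>.\<close>

definition Z_norm ::
  "real \<Rightarrow> ('x::banach \<times> 'x) set \<Rightarrow> ('x \<Rightarrow> 'e::banach) \<Rightarrow> ('e \<times> 'e) set \<Rightarrow> ('u::banach \<Rightarrow>\<^sub>L 'e)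
     \<Rightarrow> 'e \<Rightarrow> real" where
  "Z_norm \<mu> A j Am B z =
     sqrt (Inf {(norm (\<mu> *\<^sub>R x - y))\<^sup>2 + (norm u)\<^sup>2 | x y u.
                  (x, y) \<in> A \<and> z = j x + resolvent \<mu> Am (B u)})"

text \<open>\<open>\<Gamma> \<in> \<L>(Z,Y)\<close>; the values of \<open>\<Gamma>\<close> outside \<open>Z\<close> are irrelevant.\<close>

definition bounded_linear_on_Z ::
  "real \<Rightarrow> ('x::banach \<times> 'x) set \<Rightarrow> ('x \<Rightarrow> 'e::banach) \<Rightarrow> ('e \<times> 'e) set \<Rightarrow> ('u::banach \<Rightarrow>\<^sub>L 'e)
     \<Rightarrow> ('e \<Rightarrow> 'y::banach) \<Rightarrow> bool" where
  "bounded_linear_on_Z \<mu> A j Am B \<Gamma> \<longleftrightarrow>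
     (\<forall>z\<in>Z_space \<mu> A j Am B. \<forall>w\<in>Z_space \<mu> A j Am B. \<Gamma> (z + w) = \<Gamma> z + \<Gamma> w) \<and>
     (\<forall>c. \<forall>z\<in>Z_space \<mu> A j Am B. \<Gamma> (c *\<^sub>R z) = c *\<^sub>R \<Gamma> z) \<and>
     (\<exists>K. \<forall>z\<in>Z_space \<mu> A j Am B. norm (\<Gamma> z) \<le> K * Z_norm \<mu> A j Am B z)"


section \<open>Well-posed triplets\<close>

definition io_map ::
  "(real \<Rightarrow> 'e::banach \<Rightarrow>\<^sub>L 'e) \<Rightarrow> ('u::banach \<Rightarrow>\<^sub>L 'e) \<Rightarrow> ('e \<Rightarrow> 'y::banach) \<Rightarrow> ('u \<Rightarrow>\<^sub>L 'y)
     \<Rightarrow> (real \<Rightarrow> 'u) \<Rightarrow> real \<Rightarrow> 'y" where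
  "io_map S B \<Gamma> D\<^sub>\<Sigma> u t = \<Gamma> (input_map S B t u) + D\<^sub>\<Sigma> (u t)"

definition well_posed_triplet where
  "well_posed_triplet p T j S A B C \<Gamma> D\<^sub>\<Sigma> \<longleftrightarrow>
     control_admissible p j S B \<and>
     observation_admissible p T A C \<and>
     (\<forall>\<tau>>0. \<exists>\<beta>>0. \<forall>u\<in>W1p_0 p \<tau>.
        Lp_norm_pow p {0..\<tau>} (io_map S B \<Gamma> D\<^sub>\<Sigma> u) \<le> ennreal (\<beta> powr p) * Lp_norm_pow p {0..\<tau>} u)"

text \<open>
  The graph of the extension by continuity of the input-output map to
  \<open>L\<^sup>p\<^sub>l\<^sub>o\<^sub>c(\<real>\<^sub>+;U) \<rightarrow> L\<^sup>p\<^sub>l\<^sub>o\<^sub>c(\<real>\<^sub>+;Y)\<close>. For a well-posed triplet the output \<open>y\<close> is determined by \<open>u\<close>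
  almost everywhere.
\<close>

definition io_map_ext where
  "io_map_ext p S B \<Gamma> D\<^sub>\<Sigma> u y \<longleftrightarrow>
     u \<in> Lp_loc p \<and> y \<in> Lp_loc p \<and>
     (\<forall>\<tau>>0. \<exists>v. (\<forall>n. v n \<in> W1p_0 p \<tau>) \<and> Lp_tendsto p {0..\<tau>} v u \<and>
                 Lp_tendsto p {0..\<tau>} (\<lambda>n. io_map S B \<Gamma> D\<^sub>\<Sigma> (v n)) y)"

definition positive_triplet ::
  "real \<Rightarrow> (real \<Rightarrow> 'x::banach_lattice \<Rightarrow>\<^sub>L 'x) \<Rightarrow> ('x \<Rightarrow> 'e::banach) \<Rightarrow> (real \<Rightarrow> 'e \<Rightarrow>\<^sub>L 'e) \<Rightarrow> ('x \<times> 'x) set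
     \<Rightarrow> ('u::banach_lattice \<Rightarrow>\<^sub>L 'e) \<Rightarrow> ('x \<Rightarrow> 'y::banach_lattice) \<Rightarrow> ('e \<Rightarrow> 'y) \<Rightarrow> ('u \<Rightarrow>\<^sub>L 'y) \<Rightarrow> bool" where
  "positive_triplet p T j S A B C \<Gamma> D\<^sub>\<Sigma> \<longleftrightarrow>
     (\<forall>t\<ge>0. \<forall>x\<ge>0. 0 \<le> T t x) \<and>
     (\<forall>u\<ge>0. B u \<in> extrapolated_cone j) \<and>
     (\<forall>x\<in>Domain A. 0 \<le> x \<longrightarrow> 0 \<le> C x) \<and>
     (\<forall>u y. io_map_ext p S B \<Gamma> D\<^sub>\<Sigma> u y \<longrightarrow> (AE t in lebesgue_on {0..}. 0 \<le> u t)
        \<longrightarrow> (AE t in lebesgue_on {0..}. 0 \<le> y t))"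

definition positive_well_posed_triplet where
  "positive_well_posed_triplet p T j S A B C \<Gamma> D\<^sub>\<Sigma> \<longleftrightarrow>
     well_posed_triplet p T j S A B C \<Gamma> D\<^sub>\<Sigma> \<and> positive_triplet p T j S A B C \<Gamma> D\<^sub>\<Sigma>"


section \<open>Transfer function and regularity\<close>

text \<open>
  \<open>H(\<mu>) = \<Gamma> R(\<mu>,A\<^sub>-\<^sub>1) B + D\<^sub>\<Sigma>\<close> for \<open>\<mu> \<in> \<rho>(A) = \<rho>(A\<^sub>-\<^sub>1)\<close>. The scalars are real, so the transfer function appears on the real part of the resolvent set, which
  contains a half-line and is all that regularity refers to.
\<close>

definition transfer_function ::
  "('e::banach \<times> 'e) set \<Rightarrow> ('u::banach \<Rightarrow>\<^sub>L 'e) \<Rightarrow> ('e \<Rightarrow> 'y::banach) \<Rightarrow> ('u \<Rightarrow>\<^sub>L 'y)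
     \<Rightarrow> real \<Rightarrow> 'u \<Rightarrow> 'y" where
  "transfer_function Am B \<Gamma> D\<^sub>\<Sigma> \<mu> u = \<Gamma> (resolvent \<mu> Am (B u)) + D\<^sub>\<Sigma> u"

definition weakly_tendsto :: "('a \<Rightarrow> 'b::banach) \<Rightarrow> 'b \<Rightarrow> 'a filter \<Rightarrow> bool" where
  "weakly_tendsto f l F \<longleftrightarrow> (\<forall>\<phi>::'b \<Rightarrow>\<^sub>L real. ((\<lambda>x. \<phi> (f x)) \<longlongrightarrow> \<phi> l) F)"

definition strongly_regular where
  "strongly_regular Am B \<Gamma> D\<^sub>\<Sigma> \<longleftrightarrow>
     (\<forall>u. \<exists>l. ((\<lambda>\<mu>. transfer_function Am B \<Gamma> D\<^sub>\<Sigma> \<mu> u) \<longlongrightarrow> l) at_top)"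

definition weakly_regular where
  "weakly_regular Am B \<Gamma> D\<^sub>\<Sigma> \<longleftrightarrow>
     (\<forall>u. \<exists>l. weakly_tendsto (\<lambda>\<mu>. transfer_function Am B \<Gamma> D\<^sub>\<Sigma> \<mu> u) l at_top)"

definition is_feedthrough where
  "is_feedthrough Am B \<Gamma> D\<^sub>\<Sigma> (D :: 'u::banach \<Rightarrow>\<^sub>L 'y::banach) \<longleftrightarrow>
     (\<forall>u. ((\<lambda>\<mu>. transfer_function Am B \<Gamma> D\<^sub>\<Sigma> \<mu> u) \<longlongrightarrow> D u) at_top)"

end

theory Submission
  imports Defs
begin

text \<open>
  For \<open>u \<ge> 0\<close> the resolvent identity and the positivity of \<open>R(\<mu>,A)\<close>, \<open>B\<close> and \<open>C\<close> make \<open>H(\<mu>)u\<close>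
  decreasing in \<open>\<mu>\<close> for large \<open>\<mu>\<close>, and in a Banach lattice a decreasing weakly convergent family
  converges in norm: by Mazur's theorem some element above a member of the family is norm-close to
  the limit, and the norm is monotone on the positive cone. The limit is positive because
  \<open>H(\<mu>)u \<ge> 0\<close>, which is seen from the output for the single input \<open>s \<mapsto> s u\<close> at a time \<open>t < 1/\<mu>\<close>;
  no Laplace transform is needed.
\<close>

section \<open>The Hahn--Banach theorem and weak limits\<close>

text \<open>The extrapolation space has no order of its own, only the closure of the positive cone
  of X. The factor R(\<nu>,A_{-1})B must therefore be realised with values in X before positivity
  can be used; this is the purpose of \<open>L\<close>. The second obstacle is that
  \<open>\<Gamma>\<close> is bounded only for the norm of Z, so continuity of the state in X or
  X_{-1} says nothing about the output. States are written as a multiple of R(\<kappa>,A_{-1})Bu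
  plus R(\<kappa>,A) applied to a continuous X-valued function, because \<open>\<Gamma>\<close>
  after R(\<kappa>,A) is bounded on X. The ramp is the simplest input for this: a nonzero constant
  does not vanish at 0, so it is not among the inputs for which the output is given by the formula,
  while for the ramp one integration by parts produces the required form of the state.\<close>

definition sublinear :: "('a::real_vector \<Rightarrow> real) \<Rightarrow> bool" where
  "sublinear q \<longleftrightarrow> (\<forall>x y. q (x + y) \<le> q x + q y) \<and> (\<forall>x. \<forall>c\<ge>0. q (c *\<^sub>R x) = c * q x)"

lemma sublinear_add: "sublinear q \<Longrightarrow> q (x + y) \<le> q x + q y"
  and sublinear_scaleR: "sublinear q \<Longrightarrow> 0 \<le> c \<Longrightarrow> q (c *\<^sub>R x) = c * q x"
  by (auto simp: sublinear_def)

lemma sublinear_zero: "sublinear q \<Longrightarrow> q 0 = 0"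
  using sublinear_scaleR[of q 0 0] by simp

lemma sublinear_minus_ge: "sublinear q \<Longrightarrow> - q (- x) \<le> q x"
  using sublinear_add[of q x "- x"] sublinear_zero[of q] by simp

text \<open>The functional is the infimum of \<open>q (v + t *\<^sub>R k) - t * \<epsilon>\<close>
  over all \<open>t \<ge> 0\<close> and \<open>k \<in> K\<close>. One construction serves twice:
  with a singleton it drives the Zorn argument for Hahn--Banach, with a convex set it gives
  separation. Convexity is what keeps the infimum subadditive.\<close>

lemma sublinear_lower_on_convex:
  fixes q :: "'a::real_vector \<Rightarrow> real"
  assumes q: "sublinear q" and K: "convex K" "K \<noteq> {}" and ge: "\<And>k. k \<in> K \<Longrightarrow> \<epsilon> \<le> q k"
  obtains r where "sublinear r" "\<And>v. r v \<le> q v" "\<And>k. k \<in> K \<Longrightarrow> r (- k) \<le> - \<epsilon>"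
proof -
  define g where "g v tk = q (v + fst tk *\<^sub>R snd tk) - fst tk * \<epsilon>" for v :: 'a and tk :: "real \<times> 'a"
  define I where "I = {0::real..} \<times> K"
  define r where "r v = (INF tk\<in>I. g v tk)" for v
  have I_ne: "I \<noteq> {}"
    using K by (auto simp: I_def)
  \<comment> \<open>The infimum runs over unboundedly large \<open>t\<close>; it stays finite
    because \<open>\<epsilon> \<le> q k\<close> compensates the subtracted
    \<open>t * \<epsilon>\<close>.\<close>
  have lower: "- q (- v) \<le> g v tk" if "tk \<in> I" for v tk
  proof -
    obtain t k where tk: "tk = (t, k)" "0 \<le> t" "k \<in> K"
      using \<open>tk \<in> I\<close> by (cases tk) (auto simp: I_def)
    have "t * \<epsilon> \<le> q (t *\<^sub>R k)"
      using ge[OF tk(3)] tk(2) by (simp add: sublinear_scaleR[OF q] mult_left_mono)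
    also have "\<dots> \<le> q (v + t *\<^sub>R k) + q (- v)"
      using sublinear_add[OF q, of "v + t *\<^sub>R k" "- v"] by simp
    finally show ?thesis
      by (simp add: g_def tk)
  qed
  have bdd: "bdd_below (g v ` I)" for v
    using lower by (auto intro!: bdd_belowI2)
  have r_le: "r v \<le> g v tk" if "tk \<in> I" for v tk
    unfolding r_def by (rule cINF_lower[OF bdd that])
  have r_ge: "- q (- v) \<le> r v" for v
    unfolding r_def by (rule cINF_greatest[OF I_ne lower])
  obtain k0 where k0: "k0 \<in> K"
    using K by auto
  have r_le_q: "r v \<le> q v" for v
    using r_le[of "(0, k0)" v] k0 by (simp add: I_def g_def)
  have "r (v + w) \<le> r v + r w" for v w
  proof -
    have "r (v + w) \<le> g v a + g w b" if "a \<in> I" "b \<in> I" for a b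
    proof -
      obtain t k where a: "a = (t, k)" "0 \<le> t" "k \<in> K"
        using \<open>a \<in> I\<close> by (cases a) (auto simp: I_def)
      obtain s l where b: "b = (s, l)" "0 \<le> s" "l \<in> K"
        using \<open>b \<in> I\<close> by (cases b) (auto simp: I_def)
      \<comment> \<open>The sum of two rays through \<open>K\<close> must again be a ray through
        \<open>K\<close>. The weights \<open>t / (t + s)\<close> are meaningless when both
        coefficients vanish, and then any point of \<open>K\<close> will do.\<close>
      have "\<exists>m\<in>K. t *\<^sub>R k + s *\<^sub>R l = (t + s) *\<^sub>R m"
      proof (cases "t + s = 0")
        case True
        then have "t = 0" "s = 0"
          using a b by auto
        then show ?thesis
          using a by auto
      next
        case False
        then have "(t / (t + s)) *\<^sub>R k + (s / (t + s)) *\<^sub>R l \<in> K"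
          using a b by (intro convexD[OF K(1)]) (auto simp: add_divide_distrib[symmetric])
        moreover have "t *\<^sub>R k + s *\<^sub>R l
            = (t + s) *\<^sub>R ((t / (t + s)) *\<^sub>R k + (s / (t + s)) *\<^sub>R l)"
          using False by (simp add: scaleR_add_right)
        ultimately show ?thesis
          by blast
      qed
      then obtain m where m: "m \<in> K" "t *\<^sub>R k + s *\<^sub>R l = (t + s) *\<^sub>R m"
        by blast
      have "r (v + w) \<le> g (v + w) (t + s, m)"
        using a b m by (intro r_le) (auto simp: I_def)
      also have "\<dots> = q ((v + t *\<^sub>R k) + (w + s *\<^sub>R l)) - (t + s) * \<epsilon>"
        using m(2) by (simp add: g_def algebra_simps)
      also have "\<dots> \<le> g v a + g w b"
        using sublinear_add[OF q, of "v + t *\<^sub>R k" "w + s *\<^sub>R l"]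
        by (simp add: g_def a b algebra_simps)
      finally show ?thesis .
    qed
    then have "r (v + w) - g w b \<le> r v" if "b \<in> I" for b
      unfolding r_def[of v] using that by (intro cINF_greatest[OF I_ne]) (simp add: diff_le_eq)
    then have "r (v + w) - r v \<le> r w"
      unfolding r_def[of w] by (intro cINF_greatest[OF I_ne]) (smt (verit))
    then show ?thesis
      by simp
  qed
  moreover have "r (c *\<^sub>R v) = c * r v" if "0 \<le> c" for c v
  proof (cases "c = 0")
    case True
    then show ?thesis
      using r_le_q[of 0] r_ge[of 0] sublinear_zero[OF q] by simp
  next
    case False
    \<comment> \<open>One inequality is enough: applied to \<open>1 / c\<close> and
      \<open>c *\<^sub>R v\<close> it yields the reverse one.\<close>
    have le: "r (c *\<^sub>R v) \<le> c * r v" if c: "0 < c" for c v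
    proof -
      have "r (c *\<^sub>R v) / c \<le> g v a" if "a \<in> I" for a
      proof -
        obtain t k where a: "a = (t, k)" "0 \<le> t" "k \<in> K"
          using \<open>a \<in> I\<close> by (cases a) (auto simp: I_def)
        have "r (c *\<^sub>R v) \<le> g (c *\<^sub>R v) (c * t, k)"
          using a c by (intro r_le) (auto simp: I_def)
        also have "\<dots> = c * g v a"
          using sublinear_scaleR[OF q, of c "v + t *\<^sub>R k"] c
          by (simp add: g_def a algebra_simps)
        finally show ?thesis
          using c by (simp add: field_simps)
      qed
      then have "r (c *\<^sub>R v) / c \<le> r v"
        unfolding r_def[of v] by (intro cINF_greatest[OF I_ne])
      then show ?thesis
        using c by (simp add: field_simps)
    qed
    have "r ((1 / c) *\<^sub>R (c *\<^sub>R v)) \<le> (1 / c) * r (c *\<^sub>R v)"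
      using False that by (intro le) auto
    then have "c * r v \<le> r (c *\<^sub>R v)"
      using False that by (simp add: field_simps)
    then show ?thesis
      using le[of c v] False that by simp
  qed
  ultimately have "sublinear r"
    by (simp add: sublinear_def)
  moreover have "r (- k) \<le> - \<epsilon>" if "k \<in> K" for k
    using r_le[of "(1, k)" "- k"] that sublinear_zero[OF q] by (simp add: I_def g_def)
  ultimately show thesis
    using that r_le_q by blast
qed

text \<open>A minimal sublinear functional is linear: otherwise \<open>sublinear_lower_on_convex\<close>, applied to a
  one-point set, would produce a smaller one.\<close>

theorem Hahn_Banach_sublinear:
  fixes q :: "'a::real_vector \<Rightarrow> real"
  assumes q: "sublinear q"
  obtains f where "linear f" "\<And>x. f x \<le> q x"
proof -
  define F where "F = {r. sublinear r \<and> (\<forall>x. r x \<le> q x)}"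
  define P where "P r s \<longleftrightarrow> (\<forall>x. s x \<le> r x)" for r s :: "'a \<Rightarrow> real"
  \<comment> \<open>\<open>P r s\<close> says that \<open>s\<close> lies below \<open>r\<close>, so
    a maximal element for \<open>P\<close> is a pointwise minimal sublinear functional.\<close>
  have "\<exists>m\<in>F. \<forall>a\<in>F. P m a \<longrightarrow> a = m"
  proof (rule predicate_Zorn)
    show "partial_order_on F (relation_of P F)"
      by (rule partial_order_on_relation_ofI) (auto simp: P_def fun_eq_iff intro: order_trans antisym)
  next
    fix Ch assume Ch: "Ch \<in> Chains (relation_of P F)"
    then have sub: "r \<in> F" if "r \<in> Ch" for r
      using that by (auto simp: Chains_def relation_of_def)
    have chain: "P r s \<or> P s r" if "r \<in> Ch" "s \<in> Ch" for r s
      using that Ch by (auto simp: Chains_def relation_of_def)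
    show "\<exists>u\<in>F. \<forall>a\<in>Ch. P a u"
    proof (cases "Ch = {}")
      case True
      then show ?thesis
        using q by (auto simp: F_def)
    next
      case False
      define u where "u x = (INF r\<in>Ch. r x)" for x
      \<comment> \<open>The chain is bounded below pointwise: \<open>r x \<ge> - r (- x)\<close> by
        sublinearity, and \<open>r\<close> lies below \<open>q\<close> at
        \<open>- x\<close>.\<close>
      have "- q (- x) \<le> r x" if "r \<in> Ch" for r x
        using sublinear_minus_ge[of r x] sub[OF that] unfolding F_def
        by (smt (verit) mem_Collect_eq)
      then have u_le: "u x \<le> r x" if "r \<in> Ch" for r x
        unfolding u_def using that by (intro cINF_lower bdd_belowI2)
      have "u (x + y) \<le> u x + u y" for x y
      proof -
        \<comment> \<open>Two members of a chain are comparable, so the smaller one can be used at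
          \<open>x\<close> and at \<open>y\<close> simultaneously; an arbitrary family would fail
          here.\<close>
        have "u (x + y) \<le> r x + s y" if "r \<in> Ch" "s \<in> Ch" for r s
        proof -
          obtain m where m: "m \<in> Ch" "m x \<le> r x" "m y \<le> s y"
            using chain[OF \<open>r \<in> Ch\<close> \<open>s \<in> Ch\<close>] \<open>r \<in> Ch\<close> \<open>s \<in> Ch\<close>
            by (auto simp: P_def)
          have "u (x + y) \<le> m x + m y"
            using u_le[OF m(1), of "x + y"] sublinear_add[of m x y] sub[OF m(1)] by (simp add: F_def)
          with m show ?thesis
            by linarith
        qed
        then have "u (x + y) - s y \<le> u x" if "s \<in> Ch" for s
          unfolding u_def[of x] using that False by (intro cINF_greatest) (auto simp: diff_le_eq)
        then have "u (x + y) - u x \<le> u y"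
          unfolding u_def[of y] using False by (intro cINF_greatest) (auto simp: algebra_simps)
        then show ?thesis
          by simp
      qed
      moreover have "u (c *\<^sub>R x) = c * u x" if "0 \<le> c" for c x
      proof -
        have "u (c *\<^sub>R x) = (INF r\<in>Ch. c * r x)"
          unfolding u_def using sub that by (intro INF_cong) (auto simp: F_def sublinear_scaleR)
        also have "\<dots> = c * u x"
        proof (cases "c = 0")
          case True
          then show ?thesis
            using False by simp
        next
          case c: False
          show ?thesis
          proof (rule antisym)
            have "(INF r\<in>Ch. c * r x) / c \<le> u x"
              unfolding u_def[of x]
            proof (rule cINF_greatest[OF False])
              fix s assume s: "s \<in> Ch"
              have "(INF r\<in>Ch. c * r x) \<le> c * s x"
              proof (rule cINF_lower[OF _ s], rule bdd_belowI2)
                fix r assume "r \<in> Ch"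
                then show "c * u x \<le> c * r x"
                  using u_le that by (simp add: mult_left_mono)
              qed
              then show "(INF r\<in>Ch. c * r x) / c \<le> s x"
                using c that by (simp add: field_simps)
            qed
            then show "(INF r\<in>Ch. c * r x) \<le> c * u x"
              using c that by (simp add: field_simps)
            show "c * u x \<le> (INF r\<in>Ch. c * r x)"
              using False u_le that by (intro cINF_greatest) (auto simp: mult_left_mono)
          qed
        qed
        finally show ?thesis .
      qed
      moreover have "u x \<le> q x" for x
      proof -
        obtain r where r: "r \<in> Ch"
          using False by auto
        then show ?thesis
          using u_le[OF r, of x] sub[OF r] by (auto simp: F_def intro: order_trans)
      qed
      ultimately have "u \<in> F"
        by (simp add: F_def sublinear_def)
      then show ?thesis
        using u_le by (auto simp: P_def)
    qed
  qed
  then obtain m where m: "m \<in> F" and min: "\<And>a. a \<in> F \<Longrightarrow> P m a \<Longrightarrow> a = m"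
    by blast
  have sm: "sublinear m"
    using m by (simp add: F_def)
  have add: "m (x + y) = m x + m y" for x y
  proof (rule antisym)
    show "m (x + y) \<le> m x + m y"
      by (rule sublinear_add[OF sm])
    obtain r where r: "sublinear r" "\<And>v. r v \<le> m v" "r (- y) \<le> - m y"
      by (rule sublinear_lower_on_convex[OF sm, of "{y}" "m y"]) auto
    have "r = m"
      using r m by (intro min) (auto simp: F_def P_def intro: order_trans)
    then have "m (- y) \<le> - m y"
      using r by simp
    then show "m x + m y \<le> m (x + y)"
      using sublinear_add[OF sm, of "x + y" "- y"] by simp
  qed
  have neg: "m (- x) = - m x" for x
    using add[of x "- x"] sublinear_zero[OF sm] by simp
  have "linear m"
  proof (rule linearI)
    fix c :: real and x
    show "m (c *\<^sub>R x) = c *\<^sub>R m x"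
    proof (cases "0 \<le> c")
      case True
      then show ?thesis
        by (simp add: sublinear_scaleR[OF sm])
    next
      case False
      then show ?thesis
        using sublinear_scaleR[OF sm, of "- c" x] neg[of "c *\<^sub>R x"] by simp
    qed
  qed (rule add)
  then show thesis
    using that m by (simp add: F_def)
qed

text \<open>Hahn--Banach is applied to the norm lowered along \<open>K\<close>. Domination by
  \<open>r\<close> keeps \<open>f\<close> below the norm, hence bounded, and at \<open>- k\<close>
  it forces \<open>f k \<ge> \<epsilon>\<close>.\<close>

lemma convex_norm_separation:
  fixes K :: "'a::real_normed_vector set"
  assumes "convex K" and ge: "\<And>k. k \<in> K \<Longrightarrow> \<epsilon> \<le> norm k"
  obtains \<phi> :: "'a \<Rightarrow>\<^sub>L real" where "\<And>k. k \<in> K \<Longrightarrow> \<epsilon> \<le> \<phi> k"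
proof (cases "K = {}")
  case False
  have "sublinear (norm :: 'a \<Rightarrow> real)"
    by (simp add: sublinear_def norm_triangle_ineq)
  from sublinear_lower_on_convex[OF this \<open>convex K\<close> False ge] obtain r :: "'a \<Rightarrow> real"
    where r: "sublinear r" "\<And>v. r v \<le> norm v" "\<And>k. k \<in> K \<Longrightarrow> r (- k) \<le> - \<epsilon>"
    by blast
  obtain f where f: "linear f" "\<And>x. f x \<le> r x"
    using Hahn_Banach_sublinear[OF r(1)] by blast
  have le: "f x \<le> norm x" for x
    using f(2)[of x] r(2)[of x] by linarith
  have "norm (f x) \<le> norm x * 1" for x
    using le[of x] le[of "- x"] by (simp add: linear_neg[OF f(1)] abs_le_iff)
  then have bl: "bounded_linear f"
    using f(1) by (intro bounded_linear_intro[of f 1]) (auto simp: linear_add linear_scale)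
  show thesis
  proof (rule that[of "Blinfun f"])
    fix k assume "k \<in> K"
    then have "f (- k) \<le> - \<epsilon>"
      using f(2)[of "- k"] r(3)[of k] by linarith
    then show "\<epsilon> \<le> Blinfun f k"
      by (simp add: bounded_linear_Blinfun_apply[OF bl] linear_neg[OF f(1)])
  qed
qed auto

text \<open>If \<open>l\<close> had positive distance from \<open>K\<close>, a functional separating
  \<open>K - l\<close> from 0 would keep the values along \<open>f\<close> at least
  \<open>\<epsilon>\<close> above the value at \<open>l\<close>, against weak convergence. The form
  with an arbitrary convex set avoids explicit convex combinations.\<close>

theorem Mazur_weak_limit:
  fixes f :: "'i \<Rightarrow> 'a::banach"
  assumes K: "convex K" and lim: "weakly_tendsto f l F" and "F \<noteq> bot"
    and ev: "eventually (\<lambda>i. f i \<in> K) F"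
  shows "l \<in> closure K"
proof (rule ccontr)
  assume "l \<notin> closure K"
  then obtain \<epsilon> where \<epsilon>: "0 < \<epsilon>" "\<And>k. k \<in> K \<Longrightarrow> \<epsilon> \<le> dist k l"
    by (force simp: closure_approachable not_less)
  have "convex ((\<lambda>k. k - l) ` K)"
    using K by (rule convex_translation_subtract)
  moreover have "\<epsilon> \<le> norm k" if "k \<in> (\<lambda>k. k - l) ` K" for k
    using that \<epsilon> by (auto simp: dist_norm)
  ultimately obtain \<phi> :: "'a \<Rightarrow>\<^sub>L real" where \<phi>: "\<And>k. k \<in> (\<lambda>k. k - l) ` K \<Longrightarrow> \<epsilon> \<le> \<phi> k"
    using convex_norm_separation by blast
  have "eventually (\<lambda>i. \<phi> l + \<epsilon> \<le> \<phi> (f i)) F"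
    using ev by eventually_elim (use \<phi> in \<open>fastforce simp: blinfun.diff_right\<close>)
  moreover have "((\<lambda>i. \<phi> (f i)) \<longlongrightarrow> \<phi> l) F"
    using lim by (simp add: weakly_tendsto_def)
  ultimately have "\<phi> l + \<epsilon> \<le> \<phi> l"
    using \<open>F \<noteq> bot\<close> by (intro tendsto_lowerbound[of "\<lambda>i. \<phi> (f i)" _ F])
  then show False
    using \<epsilon> by simp
qed

section \<open>Banach lattices\<close>

lemma norm_mono_nonneg:
  fixes x y :: "'a::banach_lattice"
  assumes "0 \<le> x" "x \<le> y"
  shows "norm x \<le> norm y"
  using assms by (intro norm_mono_abs) (auto simp: order_trans[OF assms])

text \<open>Since \<open>nprt x\<close> is \<open>inf x 0\<close>, it lies between
  \<open>- \<bar>x - y\<bar>\<close> and 0. The estimate bounds the distance from \<open>x\<close>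
  to the cone from below and so makes the cone closed.\<close>

lemma norm_nprt_le_dist:
  fixes x y :: "'a::banach_lattice"
  assumes "0 \<le> y"
  shows "norm (nprt x) \<le> norm (x - y)"
proof (rule norm_mono_abs)
  have "- \<bar>x - y\<bar> \<le> x - y"
    using abs_ge_minus_self[of "x - y"] by (simp add: minus_le_iff)
  also have "x - y \<le> x"
    using assms by simp
  finally have "- \<bar>x - y\<bar> \<le> nprt x"
    by (simp add: nprt_def)
  then show "\<bar>nprt x\<bar> \<le> \<bar>x - y\<bar>"
    by (simp add: abs_of_nonpos minus_le_iff)
qed

lemma closed_nonneg: "closed {x::'a::banach_lattice. 0 \<le> x}"
proof -
  have "0 \<le> l" if f: "\<And>n. 0 \<le> f n" and lim: "f \<longlonglongrightarrow> l" for f :: "nat \<Rightarrow> 'a" and l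
  proof -
    have "(\<lambda>n. norm (l - f n)) \<longlonglongrightarrow> norm (l - l)"
      using lim by (intro tendsto_intros)
    then have "norm (nprt l) \<le> norm (l - l)"
      by (rule tendsto_lowerbound) (intro always_eventually allI norm_nprt_le_dist f, simp)
    then have "nprt l = 0"
      by simp
    then show ?thesis
      by (simp add: zero_le_iff_zero_nprt)
  qed
  then show ?thesis
    unfolding closed_sequential_limits by auto
qed

lemma nonneg_limit:
  fixes f :: "'i \<Rightarrow> 'a::banach_lattice"
  assumes "(f \<longlongrightarrow> l) F" "F \<noteq> bot" "eventually (\<lambda>i. 0 \<le> f i) F"
  shows "0 \<le> l"
  using Lim_in_closed_set[OF closed_nonneg, of f F l] assms by auto

lemma closed_atMost_lattice: "closed {..a::'a::banach_lattice}"
proof -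
  have "{..a} = (\<lambda>x. a - x) -` {x. 0 \<le> x}"
    by auto
  then show ?thesis
    using continuous_closed_vimage[OF closed_nonneg, of "\<lambda>x. a - x"] by (simp add: continuous_intros)
qed

text \<open>A common lower bound \<open>z\<close> of \<open>x\<close> and \<open>y\<close> also lies
  below each of their convex combinations, and everything above \<open>z\<close> belongs to
  \<open>K\<close>.\<close>

lemma convex_up_closed:
  fixes K :: "'a::banach_lattice set"
  assumes "\<And>x y. x \<in> K \<Longrightarrow> y \<in> K \<Longrightarrow> \<exists>z. z \<le> x \<and> z \<le> y \<and> {z..} \<subseteq> K"
  shows "convex K"
proof (rule convexI)
  fix x y and s t :: real
  assume xy: "x \<in> K" "y \<in> K" and st: "0 \<le> s" "0 \<le> t" "s + t = 1"
  obtain z where z: "z \<le> x" "z \<le> y" "{z..} \<subseteq> K"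
    using assms[OF xy] by blast
  have "z = s *\<^sub>R z + t *\<^sub>R z"
    using st by (simp flip: scaleR_add_left)
  also have "\<dots> \<le> s *\<^sub>R x + t *\<^sub>R y"
    using z st by (intro add_mono scaleR_left_mono)
  finally show "s *\<^sub>R x + t *\<^sub>R y \<in> K"
    using z by auto
qed

lemma convex_atMost_lattice: "convex {..a::'a::banach_lattice}"
proof (rule convexI)
  fix x y :: 'a and s t :: real
  assume xy: "x \<in> {..a}" "y \<in> {..a}" and st: "0 \<le> s" "0 \<le> t" "s + t = 1"
  have "s *\<^sub>R x + t *\<^sub>R y \<le> s *\<^sub>R a + t *\<^sub>R a"
    using xy st by (intro add_mono scaleR_left_mono) auto
  also have "\<dots> = a"
    using st by (simp flip: scaleR_add_left)
  finally show "s *\<^sub>R x + t *\<^sub>R y \<in> {..a}"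
    by simp
qed

text \<open>The increasing hull of the range is convex because the range is directed downwards, so by
  Mazur's theorem it comes arbitrarily close to the weak limit; monotonicity of the norm does the
  rest.\<close>

theorem weakly_tendsto_decreasing_imp_tendsto:
  fixes f :: "real \<Rightarrow> 'a::banach_lattice"
  assumes weak: "weakly_tendsto f l at_top"
    and decreasing: "\<And>r s. a \<le> r \<Longrightarrow> r \<le> s \<Longrightarrow> f s \<le> f r"
  shows "(f \<longlongrightarrow> l) at_top"
proof -
  \<comment> \<open>From time \<open>r\<close> on the family stays in the closed convex set
    \<open>{..f r}\<close>, so its weak limit lies there too.\<close>
  have l_le: "l \<le> f r" if "a \<le> r" for r
  proof -
    have "l \<in> closure {..f r}"
      using weak
      by (rule Mazur_weak_limit[OF convex_atMost_lattice])
        (use that decreasing in \<open>auto intro: eventually_mono[OF eventually_ge_at_top[of r]]\<close>)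
    then show ?thesis
      by (simp add: closure_closed[OF closed_atMost_lattice])
  qed
  define K where "K = (\<Union>r\<in>{a..}. {f r..})"
  have "convex K"
  proof (rule convex_up_closed)
    fix x y assume "x \<in> K" "y \<in> K"
    then obtain r s where rs: "a \<le> r" "f r \<le> x" "a \<le> s" "f s \<le> y"
      by (auto simp: K_def)
    have "{f (max r s)..} \<subseteq> K"
      using \<open>a \<le> r\<close> by (auto simp: K_def intro!: bexI[of _ "max r s"])
    then show "\<exists>z. z \<le> x \<and> z \<le> y \<and> {z..} \<subseteq> K"
      using rs decreasing[of r "max r s"] decreasing[of s "max r s"]
      by (intro exI[of _ "f (max r s)"]) (auto intro: order_trans)
  qed
  then have l: "l \<in> closure K"
    using weak by (rule Mazur_weak_limit)
      (auto simp: K_def intro!: eventually_mono[OF eventually_ge_at_top[of a]])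
  show ?thesis
  proof (rule tendstoI)
    fix e :: real assume "0 < e"
    then obtain v where v: "v \<in> K" "dist v l < e"
      using l by (auto simp: closure_approachable)
    then obtain r where r: "a \<le> r" "f r \<le> v"
      by (auto simp: K_def)
    \<comment> \<open>Sandwich \<open>0 \<le> f s - l \<le> v - l\<close>: a single close point
      \<open>v\<close> above a member controls all later members.\<close>
    have "dist (f s) l < e" if "r \<le> s" for s
    proof -
      have "norm (f s - l) \<le> norm (v - l)"
        using l_le[of s] decreasing[OF r(1) that] r that
        by (intro norm_mono_nonneg) (auto intro: order_trans)
      then show ?thesis
        using v by (simp add: dist_norm)
    qed
    then show "eventually (\<lambda>s. dist (f s) l < e) at_top"
      using eventually_ge_at_top[of r] by (rule eventually_mono[rotated])
  qed
qed

text \<open>Riemann sums of nonnegative values lie in the cone, and the cone is closed.\<close>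

lemma has_integral_nonneg_lattice:
  fixes f :: "real \<Rightarrow> 'a::banach_lattice"
  assumes f: "(f has_integral i) {a..b}" and nonneg: "\<And>x. x \<in> {a..b} \<Longrightarrow> 0 \<le> f x"
  shows "0 \<le> i"
proof -
  have "i \<in> closure {x. 0 \<le> x}"
    unfolding closure_approachable
  proof (intro allI impI)
    fix e :: real assume "0 < e"
    have "(f has_integral i) (cbox a b)"
      using f by simp
    from has_integralD[OF this \<open>0 < e\<close>] obtain \<gamma> where \<gamma>: "gauge \<gamma>"
      and small: "\<And>\<D>. \<D> tagged_division_of (cbox a b) \<Longrightarrow> \<gamma> fine \<D> \<Longrightarrow>
        norm ((\<Sum>(x,k)\<in>\<D>. measure lborel k *\<^sub>R f x) - i) < e"
      by metis
    obtain \<D> where \<D>: "\<D> tagged_division_of (cbox a b)" "\<gamma> fine \<D>"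
      using fine_division_exists[OF \<gamma>] by blast
    have "0 \<le> (\<Sum>(x,k)\<in>\<D>. measure lborel k *\<^sub>R f x)"
    proof (rule sum_nonneg, clarify)
      fix x k assume "(x, k) \<in> \<D>"
      then have "x \<in> cbox a b"
        using tagged_division_ofD(2)[OF \<D>(1)] tagged_division_ofD(3)[OF \<D>(1)] by (meson subsetD)
      then have "0 \<le> f x"
        by (intro nonneg) simp
      then show "0 \<le> measure lborel k *\<^sub>R f x"
        by (rule scaleR_nonneg_nonneg[OF measure_nonneg])
    qed
    moreover have "dist (\<Sum>(x,k)\<in>\<D>. measure lborel k *\<^sub>R f x) i < e"
      unfolding dist_norm by (rule small[OF \<D>])
    ultimately show "\<exists>y\<in>{x. 0 \<le> x}. dist y i < e"
      by (intro bexI[of _ "\<Sum>(x,k)\<in>\<D>. measure lborel k *\<^sub>R f x"] CollectI)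
  qed
  then show ?thesis
    unfolding closure_closed[OF closed_nonneg] by (rule CollectD)
qed

lemma norm_pprt_le:
  fixes x :: "'a::banach_lattice"
  shows "norm (pprt x) \<le> norm x"
proof (rule norm_mono_abs)
  have "pprt x \<le> \<bar>x\<bar>"
    unfolding pprt_def by (rule sup_least[OF abs_ge_self abs_ge_zero])
  then show "\<bar>pprt x\<bar> \<le> \<bar>x\<bar>"
    by (subst abs_of_nonneg[OF zero_le_pprt])
qed

text \<open>The splitting carries convergence from positive inputs over to all inputs; the two norm
  bounds serve the boundedness of the feedthrough operator.\<close>

lemma positive_part_decomposition:
  fixes u :: "'a::banach_lattice"
  obtains v w where "u = v - w" "0 \<le> v" "0 \<le> w" "norm v \<le> norm u" "norm w \<le> norm u"
proof (rule that[of "pprt u" "pprt (- u)"])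
  show "u = pprt u - pprt (- u)"
    unfolding pprt_neg diff_minus_eq_add by (rule prts)
  show "norm (pprt u) \<le> norm u" "norm (pprt (- u)) \<le> norm u"
    by (rule norm_pprt_le, rule order_trans[OF norm_pprt_le], simp only: norm_minus_cancel order_refl)
  show "0 \<le> pprt u" "0 \<le> pprt (- u)"
    by (rule zero_le_pprt)+
qed

section \<open>Strongly continuous semigroups and their resolvents\<close>

text \<open>By Baire one of the closed sets \<open>K m\<close> contains a ball. Every vector of norm
  \<open>r\<close> is a difference of two points of that ball, which accounts for the factor
  2.\<close>

lemma Banach_Steinhaus_sequence:
  fixes f :: "nat \<Rightarrow> 'a::banach \<Rightarrow>\<^sub>L 'b::real_normed_vector"
  assumes pointwise: "\<And>x. \<exists>c. \<forall>n. norm (f n x) \<le> c"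
  obtains M where "\<And>n. norm (f n) \<le> M"
proof -
  define K where "K m = (\<Inter>n. {x. norm (f n x) \<le> real m})" for m :: nat
  have closed_K: "closed (K m)" for m
    unfolding K_def by (intro closed_INT ballI closed_Collect_le continuous_intros)
  have "(\<Union>m. K m) = UNIV"
  proof (intro set_eqI iffI UNIV_I)
    fix x
    obtain c where c: "\<And>n. norm (f n x) \<le> c"
      using pointwise by blast
    then have "x \<in> K (nat \<lceil>c\<rceil>)"
      unfolding K_def using order_trans[OF c of_nat_ceiling] by auto
    then show "x \<in> (\<Union>m. K m)"
      by blast
  qed
  then have "\<not> (\<forall>m. interior (K m) = {})"
    using Baire_category_alt[of "euclidean :: 'a topology" "range K"] closed_K
    by (fastforce simp: completely_metrizable_space_euclidean)
  then obtain m x where "x \<in> interior (K m)"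
    by auto
  then obtain r where r: "0 < r" "cball x r \<subseteq> K m"
    by (auto simp: mem_interior_cball)
  have "norm (f n) \<le> 2 * real m / r" for n
  proof (rule norm_blinfun_bound)
    fix y :: 'a
    show "norm (f n y) \<le> 2 * real m / r * norm y"
    proof (cases "y = 0")
      case False
      define z where "z = (r / norm y) *\<^sub>R y"
      have "norm z = r"
        using False r(1) by (simp add: z_def)
      then have "x + z \<in> K m" "x \<in> K m"
        using r by (auto simp: subset_iff dist_norm)
      then have "norm (f n (x + z)) \<le> m" "norm (f n x) \<le> m"
        by (auto simp: K_def)
      moreover have "f n z = f n (x + z) - f n x"
        by (simp add: blinfun.add_right)
      ultimately have "norm (f n z) \<le> 2 * real m"
        using norm_triangle_ineq4[of "f n (x + z)" "f n x"] by simp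
      moreover have "norm (f n z) = r / norm y * norm (f n y)"
        using r(1) by (simp add: z_def blinfun.scaleR_right)
      ultimately show ?thesis
        using False r(1) by (simp add: field_simps)
    qed simp
  qed (use r in auto)
  then show thesis
    by (rule that)
qed

section \<open>Local boundedness and continuity of orbits\<close>

lemma C0_semigroupD:
  assumes "C0_semigroup T"
  shows C0_semigroup_zero: "T 0 = id_blinfun"
    and C0_semigroup_add: "0 \<le> s \<Longrightarrow> 0 \<le> t \<Longrightarrow> T (s + t) x = T s (T t x)"
    and C0_semigroup_tendsto: "((\<lambda>t. T t x) \<longlongrightarrow> x) (at_right 0)"
  using assms by (auto simp: C0_semigroup_def)

lemma C0_semigroup_commute:
  assumes "C0_semigroup T" "0 \<le> s" "0 \<le> t"
  shows "T s (T t x) = T t (T s x)"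
  using C0_semigroup_add[OF assms, of x] C0_semigroup_add[OF assms(1,3,2), of x] by (simp add: add.commute)

lemma C0_semigroup_near_zero:
  assumes "C0_semigroup T" "0 < e"
  obtains \<delta> where "0 < \<delta>" "\<And>t. 0 \<le> t \<Longrightarrow> t < \<delta> \<Longrightarrow> norm (T t x - x) < e"
proof -
  from tendstoD[OF C0_semigroup_tendsto[OF assms(1)] assms(2), of x]
  obtain \<delta> where \<delta>: "0 < \<delta>" "\<And>t. 0 < t \<Longrightarrow> t < \<delta> \<Longrightarrow> norm (T t x - x) < e"
    by (auto simp: eventually_at_right_field dist_norm)
  have "norm (T t x - x) < e" if "0 \<le> t" "t < \<delta>" for t
    using that \<delta>(2)[of t] assms(2) C0_semigroup_zero[OF assms(1)] by (cases "t = 0") auto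
  with \<delta>(1) show thesis
    by (rule that)
qed

text \<open>Otherwise the norms blow up along times \<open>\<tau> n\<close> tending to 0, although
  each orbit converges along them, contradicting Banach--Steinhaus. The normalisation
  \<open>1 \<le> M\<close> makes the powers of \<open>M\<close> increase in the next lemma.\<close>

lemma C0_semigroup_bounded_near_zero:
  assumes T: "C0_semigroup T"
  obtains \<delta> M where "0 < \<delta>" "1 \<le> M" "\<And>t. 0 \<le> t \<Longrightarrow> t \<le> \<delta> \<Longrightarrow> norm (T t) \<le> M"
proof (rule ccontr)
  assume no: "\<not> thesis"
  have "\<exists>t. 0 \<le> t \<and> t \<le> 1 / Suc n \<and> real n < norm (T t)" for n :: nat
  proof (rule ccontr)
    assume "\<not> ?thesis"
    then have "norm (T t) \<le> max 1 (real n)" if "0 \<le> t" "t \<le> 1 / Suc n" for t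
      using that by (auto simp: not_less intro: order_trans)
    then show False
      using no that[of "1 / Suc n" "max 1 (real n)"] by auto
  qed
  then obtain \<tau> where \<tau>: "\<And>n. 0 \<le> \<tau> n" "\<And>n. \<tau> n \<le> 1 / Suc n" "\<And>n. real n < norm (T (\<tau> n))"
    by metis
  have "\<exists>c. \<forall>n. norm (T (\<tau> n) x) \<le> c" for x
  proof -
    obtain \<delta> where \<delta>: "0 < \<delta>" "\<And>t. 0 \<le> t \<Longrightarrow> t < \<delta> \<Longrightarrow> norm (T t x - x) < 1"
      using C0_semigroup_near_zero[OF T zero_less_one] by blast
    have "(\<lambda>n. T (\<tau> n) x) \<longlonglongrightarrow> x"
    proof (rule tendstoI)
      fix e :: real assume "0 < e"
      obtain \<delta> where \<delta>: "0 < \<delta>" "\<And>t. 0 \<le> t \<Longrightarrow> t < \<delta> \<Longrightarrow> norm (T t x - x) < e"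
        using C0_semigroup_near_zero[OF T \<open>0 < e\<close>] by blast
      have "eventually (\<lambda>n. 1 / Suc n < \<delta>) sequentially"
        using order_tendstoD(2)[OF LIMSEQ_inverse_real_of_nat \<delta>(1)] by (simp add: divide_inverse)
      then show "eventually (\<lambda>n. dist (T (\<tau> n) x) x < e) sequentially"
      proof eventually_elim
        case (elim n)
        then show ?case
          using \<tau>(1,2)[of n] \<delta>(2)[of "\<tau> n"] by (simp add: dist_norm)
      qed
    qed
    then have "Bseq (\<lambda>n. T (\<tau> n) x)"
      by (intro convergent_imp_Bseq convergentI)
    then show ?thesis
      by (auto simp: Bseq_def)
  qed
  then obtain M where M: "\<And>n. norm (T (\<tau> n)) \<le> M"
    using Banach_Steinhaus_sequence[of "\<lambda>n. T (\<tau> n)"] by blast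
  obtain n where "M < real n"
    using reals_Archimedean2 by blast
  then show False
    using M[of n] \<tau>(3)[of n] by simp
qed

text \<open>A time below \<open>(n + 1) * \<delta>\<close> is reached in at most
  \<open>n + 1\<close> steps of length at most \<open>\<delta>\<close>, each costing a factor
  \<open>M\<close>.\<close>

lemma C0_semigroup_locally_bounded:
  assumes T: "C0_semigroup T"
  obtains M where "\<And>t. 0 \<le> t \<Longrightarrow> t \<le> b \<Longrightarrow> norm (T t) \<le> M"
proof -
  obtain \<delta> M where \<delta>: "0 < \<delta>" and M: "1 \<le> M" "\<And>t. 0 \<le> t \<Longrightarrow> t \<le> \<delta> \<Longrightarrow> norm (T t) \<le> M"
    using C0_semigroup_bounded_near_zero[OF T] by blast
  have bound: "norm (T t) \<le> M ^ Suc n" if "0 \<le> t" "t \<le> (n + 1) * \<delta>" for n :: nat and t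
    using that
  proof (induction n arbitrary: t)
    case 0
    then show ?case
      using M(2)[of t] by simp
  next
    case (Suc n)
    show ?case
    proof (cases "t \<le> \<delta>")
      case True
      then have "norm (T t) \<le> M ^ 1"
        using M Suc.prems by simp
      also have "\<dots> \<le> M ^ Suc (Suc n)"
        using M(1) by (intro power_increasing) auto
      finally show ?thesis .
    next
      case False
      have "norm (T t) = norm (T \<delta> o\<^sub>L T (t - \<delta>))"
        using T \<delta> False unfolding C0_semigroup_def
        by (metis add.commute diff_add_cancel diff_ge_0_iff_ge less_eq_real_def not_le)
      also have "\<dots> \<le> norm (T \<delta>) * norm (T (t - \<delta>))"
        by (rule norm_blinfun_compose)
      also have "\<dots> \<le> M * M ^ Suc n"
        using M Suc.prems False \<delta> by (intro mult_mono Suc.IH) (auto simp: algebra_simps)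
      finally show ?thesis
        by simp
    qed
  qed
  obtain n :: nat where "b / \<delta> \<le> n"
    using real_arch_simple by blast
  then have "b \<le> (n + 1) * \<delta>"
    using \<delta> by (simp add: field_simps)
  then show thesis
    by (intro that[of "M ^ Suc n"] bound) auto
qed

lemma C0_semigroup_continuous_on:
  assumes T: "C0_semigroup T"
  shows "continuous_on {0..} (\<lambda>t. T t x)"
  unfolding continuous_on_iff
proof (intro ballI allI impI)
  fix t e :: real assume t: "t \<in> {0..}" and "0 < e"
  obtain M where M: "\<And>s. 0 \<le> s \<Longrightarrow> s \<le> t + 1 \<Longrightarrow> norm (T s) \<le> M"
    using C0_semigroup_locally_bounded[OF T] by blast
  have "0 \<le> M"
    using M[of 0] t norm_ge_zero[of "T 0"] by (simp del: norm_ge_zero)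
  obtain \<delta> where \<delta>: "0 < \<delta>" "\<And>h. 0 \<le> h \<Longrightarrow> h < \<delta> \<Longrightarrow> norm (T h x - x) < e / (M + 1)"
    using C0_semigroup_near_zero[OF T, of "e / (M + 1)"] \<open>0 < e\<close> \<open>0 \<le> M\<close> by auto
  \<comment> \<open>Left and right continuity are the same estimate, with the semigroup at the
    earlier time factored out. The denominator \<open>M + 1\<close> covers
    \<open>M = 0\<close>.\<close>
  have step: "norm (T s x - T r x) < e" if "0 \<le> r" "r \<le> s" "r \<le> t + 1" "s - r < \<delta>" for r s
  proof -
    have "T s x - T r x = T r (T (s - r) x - x)"
      using C0_semigroup_add[OF T, of r "s - r" x] that by (simp add: blinfun.diff_right)
    then have "norm (T s x - T r x) \<le> norm (T r) * norm (T (s - r) x - x)"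
      by (simp add: norm_blinfun)
    also have "\<dots> \<le> M * (e / (M + 1))"
      using M[of r] \<delta>(2)[of "s - r"] that \<open>0 \<le> M\<close> by (intro mult_mono) auto
    also have "\<dots> < e"
      using \<open>0 \<le> M\<close> \<open>0 < e\<close> by (simp add: field_simps)
    finally show ?thesis .
  qed
  have "dist (T s x) (T t x) < e" if "s \<in> {0..}" "dist s t < min \<delta> 1" for s
  proof (cases "s \<le> t")
    case True
    then have "dist (T t x) (T s x) < e"
      using step[of s t] that by (simp add: dist_norm)
    then show ?thesis
      by (simp only: dist_commute)
  next
    case False
    then show ?thesis
      using step[of t s] that t by (simp add: dist_norm)
  qed
  then show "\<exists>d>0. \<forall>s\<in>{0..}. dist s t < d \<longrightarrow> dist (T s x) (T t x) < e"
    using \<delta>(1) by (intro exI[of _ "min \<delta> 1"]) auto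
qed

lemma C0_semigroup_continuous_on_subset:
  assumes "C0_semigroup T" "S \<subseteq> {0..}"
  shows "continuous_on S (\<lambda>t. T t x)"
  by (rule continuous_on_subset[OF C0_semigroup_continuous_on[OF assms(1)] assms(2)])

section \<open>Generators, difference quotients and integrals of orbits\<close>

lemma generator_iff:
  "(x, y) \<in> generator T \<longleftrightarrow> ((\<lambda>h. (T h x - x) /\<^sub>R h) \<longlongrightarrow> y) (at_right 0)"
  by (simp add: generator_def)

lemma generator_unique: "(x, y) \<in> generator T \<Longrightarrow> (x, z) \<in> generator T \<Longrightarrow> y = z"
  unfolding generator_iff by (rule tendsto_unique[OF trivial_limit_at_right_real])

lemma generator_scaleR:
  assumes "(x, y) \<in> generator T"
  shows "(c *\<^sub>R x, c *\<^sub>R y) \<in> generator T"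
proof -
  have "c *\<^sub>R ((T h x - x) /\<^sub>R h) = (T h (c *\<^sub>R x) - c *\<^sub>R x) /\<^sub>R h" for h
    by (simp add: blinfun.scaleR_right algebra_simps)
  then show ?thesis
    using tendsto_scaleR[OF tendsto_const assms[unfolded generator_iff], of c] by (simp add: generator_iff)
qed

text \<open>Used for three kinds of \<open>G\<close>: the integral operator over a bounded interval,
  a fixed semigroup operator, and the embedding of X into X_{-1}.\<close>

lemma generator_intertwine:
  fixes G :: "'a::banach \<Rightarrow>\<^sub>L 'b::banach" and S :: "real \<Rightarrow> 'b \<Rightarrow>\<^sub>L 'b"
  assumes "(x, y) \<in> generator T" and G: "\<And>t x. 0 \<le> t \<Longrightarrow> G (T t x) = S t (G x)"
  shows "(G x, G y) \<in> generator S"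
proof -
  have "((\<lambda>h. G ((T h x - x) /\<^sub>R h)) \<longlongrightarrow> G y) (at_right 0)"
    using assms(1) by (intro blinfun.tendsto tendsto_const) (simp add: generator_def)
  moreover have "eventually (\<lambda>h. G ((T h x - x) /\<^sub>R h) = (S h (G x) - G x) /\<^sub>R h) (at_right 0)"
    using eventually_at_right_less[of 0]
    by eventually_elim (simp add: blinfun.scaleR_right blinfun.diff_right G)
  ultimately show ?thesis
    unfolding generator_def using tendsto_cong[of "\<lambda>h. G ((T h x - x) /\<^sub>R h)"] by auto
qed

text \<open>Translates derivatives delivered by the fundamental theorem of calculus into the
  one-sided quotients in \<open>generator\<close>.\<close>

lemma has_vector_derivative_right_limit:
  fixes f :: "real \<Rightarrow> 'a::real_normed_vector"
  assumes "(f has_vector_derivative D) (at t within {t..b})" "t < b"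
  shows "((\<lambda>h. (f (t + h) - f t) /\<^sub>R h) \<longlongrightarrow> D) (at_right 0)"
proof -
  have "(f has_vector_derivative D) (at_right t)"
    using assms by (simp add: at_within_Icc_at_right)
  then have "((\<lambda>y. (1 / norm (y - t)) *\<^sub>R (f y - (f t + (y - t) *\<^sub>R D))) \<longlongrightarrow> 0) (at_right t)"
    unfolding has_vector_derivative_def has_derivative_within by simp
  moreover have "eventually (\<lambda>y. (1 / norm (y - t)) *\<^sub>R (f y - (f t + (y - t) *\<^sub>R D))
      = (f y - f t) /\<^sub>R (y - t) - D) (at_right t)"
    using eventually_at_right_less[of t]
    by eventually_elim (simp add: scaleR_diff_right scaleR_add_right divide_inverse)
  ultimately have "((\<lambda>y. (f y - f t) /\<^sub>R (y - t) - D) \<longlongrightarrow> 0) (at_right t)"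
    by (rule Lim_transform_eventually)
  then have "((\<lambda>y. (f y - f t) /\<^sub>R (y - t)) \<longlongrightarrow> D) (at_right t)"
    by (rule LIM_zero_cancel)
  then show ?thesis
    by (subst (asm) filterlim_at_right_to_0) (simp add: add.commute)
qed

lemma has_vector_derivative_indefinite_integral:
  fixes f :: "real \<Rightarrow> 'a::banach"
  assumes "continuous_on {0..} f" "0 \<le> t" "0 \<le> s" "s \<le> t"
  shows "((\<lambda>t. integral {0..t} f) has_vector_derivative f s) (at s within {0..t})"
  using assms by (intro integral_has_vector_derivative continuous_on_subset[OF assms(1)]) auto

text \<open>Substitution through an antiderivative: the indefinite integral of \<open>f\<close>,
  composed with the shift, is differentiated by the chain rule. The reflection below is treated in
  the same way.\<close>

lemma has_integral_shift_continuous: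
  fixes f :: "real \<Rightarrow> 'a::banach"
  assumes f: "continuous_on {0..} f" and "0 \<le> t" "0 \<le> h"
  shows "((\<lambda>s. f (s + h)) has_integral (integral {0..t + h} f - integral {0..h} f)) {0..t}"
proof -
  have "((\<lambda>s. integral {0..s + h} f) has_vector_derivative f (s + h)) (at s within {0..t})"
    if "s \<in> {0..t}" for s
  proof -
    have "((\<lambda>t. integral {0..t} f) has_vector_derivative f (s + h)) (at (s + h) within {0..t + h})"
      using that assms by (intro has_vector_derivative_indefinite_integral) auto
    then have "((\<lambda>t. integral {0..t} f) has_vector_derivative f (s + h))
        (at (s + h) within (\<lambda>s. s + h) ` {0..t})"
      by (rule has_vector_derivative_within_subset) (use \<open>0 \<le> h\<close> in auto)
    then have "((\<lambda>t. integral {0..t} f) \<circ> (\<lambda>s. s + h) has_vector_derivative 1 *\<^sub>R f (s + h))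
        (at s within {0..t})"
      by (intro vector_diff_chain_within derivative_eq_intros) auto
    then show ?thesis
      by (simp add: o_def)
  qed
  from fundamental_theorem_of_calculus[OF \<open>0 \<le> t\<close> this] show ?thesis
    by simp
qed

lemma integral_reflect_continuous:
  fixes f :: "real \<Rightarrow> 'a::banach"
  assumes f: "continuous_on {0..} f" and "0 \<le> t"
  shows "integral {0..t} (\<lambda>s. f (t - s)) = integral {0..t} f"
proof -
  have "((\<lambda>s. - integral {0..t - s} f) has_vector_derivative f (t - s)) (at s within {0..t})"
    if "s \<in> {0..t}" for s
  proof -
    have "((\<lambda>t. integral {0..t} f) has_vector_derivative f (t - s)) (at (t - s) within {0..t})"
      using that assms by (intro has_vector_derivative_indefinite_integral) auto
    then have "((\<lambda>t. integral {0..t} f) has_vector_derivative f (t - s))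
        (at (t - s) within (\<lambda>s. t - s) ` {0..t})"
      by (rule has_vector_derivative_within_subset) auto
    then have "((\<lambda>t. integral {0..t} f) \<circ> (\<lambda>s. t - s) has_vector_derivative (- 1) *\<^sub>R f (t - s))
        (at s within {0..t})"
      by (intro vector_diff_chain_within derivative_eq_intros) auto
    then show ?thesis
      using has_vector_derivative_minus by (fastforce simp: o_def)
  qed
  from fundamental_theorem_of_calculus[OF \<open>0 \<le> t\<close> this] show ?thesis
    by (simp add: integral_unique)
qed

lemma blinfun_integral:
  fixes f :: "real \<Rightarrow> 'a::banach" and G :: "'a \<Rightarrow>\<^sub>L 'b::banach"
  assumes "continuous_on {a..b} f"
  shows "G (integral {a..b} f) = integral {a..b} (\<lambda>s. G (f s))"
  using integral_linear[OF integrable_continuous_real[OF assms] blinfun.bounded_linear_right, of G]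
  by (simp add: o_def)

text \<open>Shifting the orbit by \<open>h\<close> turns the quotient at \<open>?F t\<close> into
  the difference of the quotients of the function \<open>?F\<close> at the times \<open>t\<close>
  and 0.\<close>

lemma generator_integral:
  assumes T: "C0_semigroup T" and "0 \<le> t"
  shows "(integral {0..t} (\<lambda>s. T s x), T t x - x) \<in> generator T"
proof -
  let ?F = "\<lambda>t. integral {0..t} (\<lambda>s. T s x)"
  note cont = C0_semigroup_continuous_on[OF T]
  have deriv: "((\<lambda>h. (?F (r + h) - ?F r) /\<^sub>R h) \<longlongrightarrow> T r x) (at_right 0)" if "0 \<le> r" for r
    using that
    by (intro has_vector_derivative_right_limit[where b = "r + 1"]
        has_vector_derivative_within_subset[OF has_vector_derivative_indefinite_integral[OF cont, of "r + 1"]])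
      auto
  have "((\<lambda>h. (?F (t + h) - ?F t) /\<^sub>R h - (?F (0 + h) - ?F 0) /\<^sub>R h) \<longlongrightarrow> T t x - T 0 x) (at_right 0)"
    using \<open>0 \<le> t\<close> by (intro tendsto_diff deriv) auto
  then have lim: "((\<lambda>h. (?F (t + h) - ?F t) /\<^sub>R h - ?F h /\<^sub>R h) \<longlongrightarrow> T t x - x) (at_right 0)"
    by (simp add: C0_semigroup_zero[OF T])
  have "eventually (\<lambda>h. (?F (t + h) - ?F t) /\<^sub>R h - ?F h /\<^sub>R h = (T h (?F t) - ?F t) /\<^sub>R h) (at_right 0)"
    using eventually_at_right_less[of 0]
  proof eventually_elim
    case (elim h)
    have "T h (?F t) = integral {0..t} (\<lambda>s. T h (T s x))"
      by (rule blinfun_integral[OF C0_semigroup_continuous_on_subset[OF T]]) auto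
    also have "\<dots> = integral {0..t} (\<lambda>s. T (s + h) x)"
      using elim by (intro integral_cong) (simp add: C0_semigroup_add[OF T, symmetric] add.commute)
    also have "\<dots> = ?F (t + h) - ?F h"
      using has_integral_shift_continuous[OF cont \<open>0 \<le> t\<close>, of h] elim by (simp add: integral_unique)
    finally show ?case
      by (simp add: scaleR_diff_right)
  qed
  from Lim_transform_eventually[OF lim this] show ?thesis
    by (simp add: generator_def)
qed

text \<open>Integration over the orbit is packaged as a bounded operator commuting with the
  semigroup, so that \<open>generator_intertwine\<close> applies to it.\<close>

lemma C0_semigroup_integral_blinfun:
  assumes T: "C0_semigroup T" and "0 \<le> t"
  obtains V where "\<And>x. blinfun_apply V x = integral {0..t} (\<lambda>s. T s x)"
    and "\<And>s x. 0 \<le> s \<Longrightarrow> V (T s x) = T s (V x)"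
proof -
  note cont = C0_semigroup_continuous_on_subset[OF T, of "{0..t}", simplified]
  define V where "V x = integral {0..t} (\<lambda>s. T s x)" for x
  obtain M where M: "\<And>s. 0 \<le> s \<Longrightarrow> s \<le> t \<Longrightarrow> norm (T s) \<le> M"
    using C0_semigroup_locally_bounded[OF T] by blast
  have "bounded_linear V"
  proof (rule bounded_linear_intro)
    fix v w :: 'a and c :: real
    show "V (v + w) = V v + V w"
      unfolding V_def blinfun.add_right by (intro integral_add integrable_continuous_real cont)
    show "V (c *\<^sub>R v) = c *\<^sub>R V v"
      by (simp add: V_def blinfun.scaleR_right)
    have "norm (T s v) \<le> M * norm v" if "s \<in> {0..t}" for s
      using that M[of s] by (intro order_trans[OF norm_blinfun mult_right_mono]) auto
    then have "norm (V v) \<le> (M * norm v) * (t - 0)"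
      unfolding V_def by (intro integral_bound \<open>0 \<le> t\<close> cont) auto
    then show "norm (V v) \<le> norm v * (M * t)"
      by (simp add: mult_ac)
  qed
  then have V: "blinfun_apply (Blinfun V) = V"
    by (rule bounded_linear_Blinfun_apply)
  have "V (T s x) = T s (V x)" if "0 \<le> s" for s x
  proof -
    have "T s (V x) = integral {0..t} (\<lambda>r. T s (T r x))"
      unfolding V_def by (rule blinfun_integral[OF cont])
    also have "\<dots> = V (T s x)"
      unfolding V_def using that by (intro integral_cong) (simp add: C0_semigroup_commute[OF T])
    finally show ?thesis ..
  qed
  then show thesis
    by (intro that[of "Blinfun V"]) (simp_all add: V V_def)
qed

text \<open>The generator is evaluated at \<open>V x\<close> in two ways: commutation gives
  \<open>V y\<close>, and \<open>generator_integral\<close> gives \<open>T t x - x\<close>. The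
  generator is single-valued.\<close>

lemma integral_generator:
  assumes T: "C0_semigroup T" and "0 \<le> t" and xy: "(x, y) \<in> generator T"
  shows "integral {0..t} (\<lambda>s. T s y) = T t x - x"
proof -
  obtain V where V: "\<And>x. blinfun_apply V x = integral {0..t} (\<lambda>s. T s x)"
    and commute: "\<And>s x. 0 \<le> s \<Longrightarrow> V (T s x) = T s (V x)"
    using C0_semigroup_integral_blinfun[OF assms(1,2)] by metis
  have "(V x, V y) \<in> generator T"
    by (rule generator_intertwine[OF xy commute])
  moreover have "(V x, T t x - x) \<in> generator T"
    using generator_integral[OF T \<open>0 \<le> t\<close>] by (simp add: V)
  ultimately have "V y = T t x - x"
    by (rule generator_unique)
  then show ?thesis
    by (simp add: V)
qed

text \<open>The orbit is an indefinite integral of a continuous function, so the left derivative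
  comes along with the right one.\<close>

lemma generator_has_vector_derivative:
  assumes T: "C0_semigroup T" and "(x, y) \<in> generator T" and "0 \<le> s" "s \<le> t"
  shows "((\<lambda>s. T s x) has_vector_derivative T s y) (at s within {0..t})"
proof -
  have "((\<lambda>s. x + integral {0..s} (\<lambda>s. T s y)) has_vector_derivative 0 + T s y) (at s within {0..t})"
    using assms by (intro has_vector_derivative_add has_vector_derivative_const
        has_vector_derivative_indefinite_integral C0_semigroup_continuous_on) auto
  then show ?thesis
    unfolding add_0_left
    by (rule has_vector_derivative_transform[rotated 2])
      (use assms in \<open>auto simp: integral_generator\<close>)
qed

section \<open>Algebra of resolvents and intertwining operators\<close>

lemma is_resolvent_unique:
  assumes "is_resolvent \<kappa> A R" "is_resolvent \<kappa> A Q"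
  shows "R = Q"
proof (rule blinfun_eqI)
  fix z
  have "(Q z, \<kappa> *\<^sub>R Q z - z) \<in> A"
    using assms(2) by (simp add: is_resolvent_def)
  with assms(1) have "R (\<kappa> *\<^sub>R Q z - (\<kappa> *\<^sub>R Q z - z)) = Q z"
    unfolding is_resolvent_def by fast
  then show "R z = Q z"
    by simp
qed

lemma resolvent_eq: "is_resolvent \<kappa> A R \<Longrightarrow> resolvent \<kappa> A = R"
  unfolding resolvent_def by (blast intro: is_resolvent_unique)

lemma is_resolventD:
  assumes "is_resolvent \<kappa> A R"
  shows is_resolvent_graph: "(R z, \<kappa> *\<^sub>R R z - z) \<in> A"
    and is_resolvent_left: "(x, y) \<in> A \<Longrightarrow> R (\<kappa> *\<^sub>R x - y) = x"
  using assms by (auto simp: is_resolvent_def)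

text \<open>Since \<open>Q z\<close> lies in the domain, the left inverse property of
  \<open>R\<close> can be applied to the graph point supplied by \<open>Q\<close>.\<close>

lemma resolvent_identity:
  assumes "is_resolvent \<kappa> A R" "is_resolvent \<nu> A Q"
  shows "R z - Q z = (\<nu> - \<kappa>) *\<^sub>R R (Q z)"
  using is_resolvent_left[OF assms(1) is_resolvent_graph[OF assms(2), of z]]
  by (simp add: blinfun.diff_right blinfun.add_right blinfun.scaleR_right algebra_simps)

lemma resolvent_intertwine:
  fixes G :: "'a::banach \<Rightarrow>\<^sub>L 'b::banach"
  assumes "is_resolvent \<kappa> (generator T) R" "is_resolvent \<kappa> (generator S) Q"
    and G: "\<And>t x. 0 \<le> t \<Longrightarrow> G (T t x) = S t (G x)"
  shows "Q (G z) = G (R z)"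
proof -
  have "(G (R z), G (\<kappa> *\<^sub>R R z - z)) \<in> generator S"
    by (rule generator_intertwine[OF is_resolvent_graph[OF assms(1)] G])
  from is_resolvent_left[OF assms(2) this] show ?thesis
    by (simp add: blinfun.diff_right blinfun.scaleR_right)
qed

lemma resolvent_commute:
  assumes "C0_semigroup T" "is_resolvent \<kappa> (generator T) R" "0 \<le> t"
  shows "R (T t x) = T t (R x)"
  by (rule resolvent_intertwine[OF assms(2,2)]) (rule C0_semigroup_commute[OF assms(1,3)])

section \<open>Existence and positivity of resolvents for large real \<kappa>\<close>

lemma C0_semigroup_rescale:
  assumes T: "C0_semigroup T"
  shows "C0_semigroup (\<lambda>t. exp (c * t) *\<^sub>R T t)"
proof -
  have "((\<lambda>t. exp (c * t) *\<^sub>R T t x) \<longlongrightarrow> exp (c * 0) *\<^sub>R x) (at_right 0)" for x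
    by (intro tendsto_intros C0_semigroup_tendsto[OF T])
  moreover have "exp (c * (s + t)) *\<^sub>R T (s + t) = (exp (c * s) *\<^sub>R T s) o\<^sub>L (exp (c * t) *\<^sub>R T t)"
    if "0 \<le> s" "0 \<le> t" for s t
    using that C0_semigroup_add[OF T]
    by (intro blinfun_eqI) (simp add: blinfun.scaleR_left blinfun.scaleR_right exp_add distrib_left)
  ultimately show ?thesis
    using T by (simp add: C0_semigroup_def blinfun.scaleR_left)
qed

lemma generator_rescale_aux:
  assumes "C0_semigroup T" "(x, y) \<in> generator T"
  shows "(x, y + c *\<^sub>R x) \<in> generator (\<lambda>t. exp (c * t) *\<^sub>R T t)"
proof -
  have "((\<lambda>t. (exp (c * t) - 1) / t) \<longlongrightarrow> c) (at_right 0)"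
  proof -
    have "((\<lambda>t. exp (c * t)) has_real_derivative c) (at 0)"
      by (auto intro!: derivative_eq_intros)
    then show ?thesis
      by (simp add: has_field_derivative_iff filterlim_at_split)
  qed
  moreover have "((\<lambda>t. exp (c * t)) \<longlongrightarrow> exp (c * 0)) (at_right 0)"
    by (intro tendsto_intros)
  moreover have "((\<lambda>h. (T h x - x) /\<^sub>R h) \<longlongrightarrow> y) (at_right 0)"
    using assms(2) by (simp add: generator_def)
  ultimately have "((\<lambda>h. exp (c * h) *\<^sub>R ((T h x - x) /\<^sub>R h) + ((exp (c * h) - 1) / h) *\<^sub>R x)
      \<longlongrightarrow> exp (c * 0) *\<^sub>R y + c *\<^sub>R x) (at_right 0)"
    by (intro tendsto_intros)
  moreover have "exp (c * h) *\<^sub>R ((T h x - x) /\<^sub>R h) + ((exp (c * h) - 1) / h) *\<^sub>R x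
      = ((exp (c * h) *\<^sub>R T h) x - x) /\<^sub>R h" for h
    by (simp add: blinfun.scaleR_left algebra_simps divide_inverse)
  ultimately show ?thesis
    by (simp add: generator_def)
qed

lemma generator_rescale:
  assumes T: "C0_semigroup T"
  shows "(x, y + c *\<^sub>R x) \<in> generator (\<lambda>t. exp (c * t) *\<^sub>R T t) \<longleftrightarrow> (x, y) \<in> generator T"
proof
  assume "(x, y + c *\<^sub>R x) \<in> generator (\<lambda>t. exp (c * t) *\<^sub>R T t)"
  from generator_rescale_aux[OF C0_semigroup_rescale[OF T] this, of "- c"]
  show "(x, y) \<in> generator T"
    by (simp flip: exp_add)
qed (rule generator_rescale_aux[OF T])

text \<open>The Neumann series in fixed point form: \<open>N z\<close> is the fixed point of the
  contraction \<open>\<lambda>y. Q y + z\<close>. It therefore lies in every nonempty closed set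
  invariant under that contraction; with the positive cone as \<open>K\<close> this gives
  positivity.\<close>

lemma one_minus_blinfun_inverse:
  fixes Q :: "'a::banach \<Rightarrow>\<^sub>L 'a"
  assumes Q: "norm Q < 1"
  obtains N :: "'a \<Rightarrow>\<^sub>L 'a" where "\<And>z. N z = Q (N z) + z" "\<And>z. N (z - Q z) = z"
    and "\<And>K z. closed K \<Longrightarrow> K \<noteq> {} \<Longrightarrow> (\<And>y. y \<in> K \<Longrightarrow> Q y + z \<in> K) \<Longrightarrow> N z \<in> K"
proof -
  have dist: "dist (Q x + z) (Q y + z) \<le> norm Q * dist x y" for x y z
    using norm_blinfun[of Q "x - y"] by (simp add: dist_norm blinfun.diff_right)
  have "\<exists>!y. Q y + z = y" for z
    using Q dist by (intro banach_fix_type[of "norm Q"]) auto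
  then obtain n where fix_n: "\<And>z. Q (n z) + z = n z" and unique: "\<And>y z. Q y + z = y \<Longrightarrow> y = n z"
    by metis
  have "bounded_linear n"
  proof (rule bounded_linear_intro)
    fix v w :: 'a and c :: real
    show "n (v + w) = n v + n w"
    proof (rule unique[symmetric])
      have "Q (n v + n w) + (v + w) = (Q (n v) + v) + (Q (n w) + w)"
        by (simp add: blinfun.add_right)
      then show "Q (n v + n w) + (v + w) = n v + n w"
        by (simp only: fix_n)
    qed
    show "n (c *\<^sub>R v) = c *\<^sub>R n v"
      by (intro unique[symmetric]) (simp add: blinfun.scaleR_right fix_n flip: scaleR_add_right)
    have "norm (n v) \<le> norm (Q (n v)) + norm v"
      using norm_triangle_ineq[of "Q (n v)" v] by (simp add: fix_n)
    also have "\<dots> \<le> norm Q * norm (n v) + norm v"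
      using norm_blinfun[of Q "n v"] by simp
    finally show "norm (n v) \<le> norm v * (1 / (1 - norm Q))"
      using Q by (simp add: field_simps)
  qed
  then have N: "blinfun_apply (Blinfun n) = n"
    by (rule bounded_linear_Blinfun_apply)
  show thesis
  proof (rule that[of "Blinfun n"])
    fix z
    show "Blinfun n z = Q (Blinfun n z) + z"
      by (simp add: N fix_n)
    show "Blinfun n (z - Q z) = z"
      unfolding N by (rule unique[symmetric]) simp
  next
    fix K z assume K: "closed K" "K \<noteq> {}" "\<And>y. y \<in> K \<Longrightarrow> Q y + z \<in> K"
    have "\<exists>!y\<in>K. Q y + z = y"
      using K Q dist by (intro Banach_fix[of K "norm Q"]) (auto simp: complete_eq_closed)
    then show "Blinfun n z \<in> K"
      unfolding N using unique by metis
  qed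
qed

text \<open>The Laplace integral over \<open>[0,\<infinity>)\<close> is summed as a geometric series over intervals of unit length.\<close>

lemma C0_semigroup_resolvent:
  assumes T: "C0_semigroup T" and small: "exp (- \<kappa>) * norm (T 1) < 1"
  obtains R N where "is_resolvent \<kappa> (generator T) R"
    and "\<And>z. blinfun_apply R z = integral {0..1} (\<lambda>s. exp (- \<kappa> * s) *\<^sub>R T s (blinfun_apply N z))"
    and "\<And>K z. closed K \<Longrightarrow> K \<noteq> {} \<Longrightarrow> (\<And>y. y \<in> K \<Longrightarrow> exp (- \<kappa>) *\<^sub>R T 1 y + z \<in> K) \<Longrightarrow> N z \<in> K"
proof -
  define T' where "T' t = exp (- \<kappa> * t) *\<^sub>R T t" for t
  have T': "C0_semigroup T'"
    unfolding T'_def by (rule C0_semigroup_rescale[OF T])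
  have gen: "(x, y) \<in> generator T' \<longleftrightarrow> (x, \<kappa> *\<^sub>R x + y) \<in> generator T" for x y
    using generator_rescale[OF T, of x "\<kappa> *\<^sub>R x + y" "- \<kappa>"] by (simp add: T'_def[abs_def])
  have "norm (T' 1) < 1"
    using small by (simp add: T'_def)
  then obtain N where N: "\<And>z. blinfun_apply N z = T' 1 (N z) + z" "\<And>z. N (z - T' 1 z) = z"
    and N_in: "\<And>K z. closed K \<Longrightarrow> K \<noteq> {} \<Longrightarrow> (\<And>y. y \<in> K \<Longrightarrow> T' 1 y + z \<in> K) \<Longrightarrow> N z \<in> K"
    using one_minus_blinfun_inverse by metis
  obtain V where V: "\<And>x. blinfun_apply V x = integral {0..1} (\<lambda>s. T' s x)"
    and commute: "\<And>s x. 0 \<le> s \<Longrightarrow> V (T' s x) = T' s (V x)"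
    using C0_semigroup_integral_blinfun[OF T' zero_le_one] by metis
  \<comment> \<open>The graph condition produces \<open>V\<close> after \<open>N\<close>, while the
    left inverse condition needs \<open>N\<close> after \<open>V\<close>. They agree since
    \<open>V\<close> commutes with \<open>T' 1\<close>.\<close>
  have NV: "N (V z) = V (N z)" for z
  proof -
    have "V z = V (N z) - T' 1 (V (N z))"
      using arg_cong[OF N(1)[of z], of V] by (simp add: blinfun.add_right commute eq_diff_eq add.commute)
    then show ?thesis
      using N(2)[of "V (N z)"] by simp
  qed
  have "(V (N z), \<kappa> *\<^sub>R V (N z) - z) \<in> generator T" for z
  proof -
    have "T' 1 (N z) - N z = - z"
      using N(1)[of z] by (simp add: algebra_simps)
    then have "(V (N z), - z) \<in> generator T'"
      using generator_integral[OF T', of 1 "N z"] by (simp add: V)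
    then show ?thesis
      by (simp add: gen)
  qed
  moreover have "V (N (\<kappa> *\<^sub>R x - y)) = x" if "(x, y) \<in> generator T" for x y
  proof -
    have "V (y - \<kappa> *\<^sub>R x) = T' 1 x - x"
      using that integral_generator[OF T' zero_le_one, of x "y - \<kappa> *\<^sub>R x"] by (simp add: V gen)
    then have "V (\<kappa> *\<^sub>R x - y) = x - T' 1 x"
      by (metis blinfun.minus_right minus_diff_eq)
    then show ?thesis
      using N(2)[of x] by (simp flip: NV)
  qed
  ultimately have "is_resolvent \<kappa> (generator T) (V o\<^sub>L N)"
    by (auto simp: is_resolvent_def)
  then show thesis
    using N_in by (intro that[of "V o\<^sub>L N" N]) (simp_all add: V T'_def blinfun.scaleR_left)
qed

lemma eventually_exp_minus_mult_less_one: "eventually (\<lambda>\<kappa>::real. exp (- \<kappa>) * c < 1) at_top"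
proof -
  have "((\<lambda>\<kappa>::real. exp (- \<kappa>) * c) \<longlongrightarrow> 0) at_top"
    by (intro tendsto_mult_left_zero filterlim_compose[OF exp_at_bot] filterlim_uminus_at_bot_at_top)
  then show ?thesis
    by (rule order_tendstoD(2)) simp
qed

lemma eventually_resolvent:
  assumes "C0_semigroup T"
  shows "eventually (\<lambda>\<kappa>. \<exists>R. is_resolvent \<kappa> (generator T) R) at_top"
  using eventually_exp_minus_mult_less_one[of "norm (T 1)"]
  by eventually_elim (metis C0_semigroup_resolvent[OF assms])

text \<open>For \<open>z \<ge> 0\<close> the map
  \<open>\<lambda>y. exp (- \<kappa>) *\<^sub>R T 1 y + z\<close> preserves the closed cone, so its
  fixed point \<open>N z\<close> is positive, and integrating the orbit keeps it so.\<close>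

lemma eventually_positive_resolvent:
  fixes T :: "real \<Rightarrow> 'a::banach_lattice \<Rightarrow>\<^sub>L 'a"
  assumes T: "C0_semigroup T" and pos: "\<And>t x. 0 \<le> t \<Longrightarrow> 0 \<le> x \<Longrightarrow> 0 \<le> T t x"
  shows "eventually (\<lambda>\<kappa>. \<exists>R. is_resolvent \<kappa> (generator T) R \<and> (\<forall>z\<ge>0. 0 \<le> R z)) at_top"
  using eventually_exp_minus_mult_less_one[of "norm (T 1)"]
proof eventually_elim
  case (elim \<kappa>)
  obtain R N where R: "is_resolvent \<kappa> (generator T) R"
    "\<And>z. blinfun_apply R z = integral {0..1} (\<lambda>s. exp (- \<kappa> * s) *\<^sub>R T s (blinfun_apply N z))"
    and N: "\<And>K z. closed K \<Longrightarrow> K \<noteq> {} \<Longrightarrow> (\<And>y. y \<in> K \<Longrightarrow> exp (- \<kappa>) *\<^sub>R T 1 y + z \<in> K) \<Longrightarrow> N z \<in> K"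
    using C0_semigroup_resolvent[OF T elim] by blast
  have "0 \<le> R z" if "0 \<le> z" for z
  proof -
    have "N z \<in> {x. 0 \<le> x}"
      using that by (intro N closed_nonneg) (auto intro!: add_nonneg_nonneg scaleR_nonneg_nonneg pos)
    then have "0 \<le> exp (- \<kappa> * s) *\<^sub>R T s (N z)" if "0 \<le> s" for s
      using that by (intro scaleR_nonneg_nonneg pos) auto
    moreover have "continuous_on {0..1} (\<lambda>s. exp (- \<kappa> * s) *\<^sub>R T s (N z))"
      by (intro continuous_intros C0_semigroup_continuous_on_subset[OF T]) auto
    ultimately show ?thesis
      unfolding R(2)
      by (intro has_integral_nonneg_lattice[OF integrable_integral[OF integrable_continuous_real]]) auto
  qed
  with R(1) show ?case
    by blast
qed

section \<open>Integrals of orbits as values of the resolvent\<close>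

lemma resolvent_semigroup_integral:
  assumes T: "C0_semigroup T" and R: "is_resolvent \<kappa> (generator T) R" and "0 \<le> t"
  shows "integral {0..t} (\<lambda>s. T s x) = R (\<kappa> *\<^sub>R integral {0..t} (\<lambda>s. T s x) - T t x + x)"
  using is_resolvent_left[OF R generator_integral[OF T \<open>0 \<le> t\<close>, of x]] by (simp add: algebra_simps)

text \<open>Integration by parts for \<open>\<lambda>s. (t - s) *\<^sub>R T s k\<close>, which
  vanishes at \<open>s = t\<close> and equals \<open>t *\<^sub>R k\<close> at
  \<open>s = 0\<close>.\<close>

lemma integral_ramp_generator:
  assumes T: "C0_semigroup T" and kv: "(k, v) \<in> generator T" and "0 \<le> t"
  shows "integral {0..t} (\<lambda>s. (t - s) *\<^sub>R T s v) = integral {0..t} (\<lambda>s. T s k) - t *\<^sub>R k"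
proof -
  note cont = C0_semigroup_continuous_on_subset[OF T, of "{0..t}", simplified]
  have "((\<lambda>s. (t - s) *\<^sub>R T s k) has_vector_derivative (t - s) *\<^sub>R T s v + (- 1) *\<^sub>R T s k)
      (at s within {0..t})" if "s \<in> {0..t}" for s
    using that
    by (intro has_vector_derivative_scaleR generator_has_vector_derivative[OF T kv])
      (auto intro!: derivative_eq_intros)
  from fundamental_theorem_of_calculus[OF \<open>0 \<le> t\<close> this]
  have "((\<lambda>s. (t - s) *\<^sub>R T s v - T s k) has_integral - (t *\<^sub>R k)) {0..t}"
    by (simp add: C0_semigroup_zero[OF T])
  then have "- (t *\<^sub>R k) = integral {0..t} (\<lambda>s. (t - s) *\<^sub>R T s v - T s k)"
    by (rule integral_unique[symmetric])
  also have "\<dots> = integral {0..t} (\<lambda>s. (t - s) *\<^sub>R T s v) - integral {0..t} (\<lambda>s. T s k)"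
    by (intro integral_diff integrable_continuous_real continuous_intros cont)
  finally show ?thesis
    by (simp add: algebra_simps)
qed

text \<open>Integration by parts requires a vector in the domain, so it is applied to
  \<open>R x\<close>; then \<open>R\<close> is pulled out of the integrals, and the identity holds
  for every \<open>x\<close>. It is used both for \<open>S\<close>, to compute the state, and for
  \<open>T\<close>, to exhibit the state as a value of R(\<kappa>,A).\<close>

lemma resolvent_semigroup_ramp_integral:
  assumes T: "C0_semigroup T" and R: "is_resolvent \<kappa> (generator T) R" and "0 \<le> t"
  shows "integral {0..t} (\<lambda>s. (t - s) *\<^sub>R T s x)
    = R (\<kappa> *\<^sub>R integral {0..t} (\<lambda>s. (t - s) *\<^sub>R T s x) - integral {0..t} (\<lambda>s. T s x) + t *\<^sub>R x)"
proof -
  note cont = C0_semigroup_continuous_on_subset[OF T, of "{0..t}", simplified]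
  let ?F = "\<lambda>x. integral {0..t} (\<lambda>s. T s x)" and ?G = "\<lambda>x. integral {0..t} (\<lambda>s. (t - s) *\<^sub>R T s x)"
  have cont_G: "continuous_on {0..t} (\<lambda>s. (t - s) *\<^sub>R T s x)" for x
    by (intro continuous_intros cont)
  have F: "?F (R x) = R (?F x)"
    unfolding blinfun_integral[OF cont] by (intro integral_cong) (simp add: resolvent_commute[OF T R])
  have G: "?G (R x) = R (?G x)"
    unfolding blinfun_integral[OF cont_G]
    by (intro integral_cong) (simp add: resolvent_commute[OF T R] blinfun.scaleR_right)
  have "?G (\<kappa> *\<^sub>R R x - x) = ?F (R x) - t *\<^sub>R R x"
    by (rule integral_ramp_generator[OF T is_resolvent_graph[OF R] \<open>0 \<le> t\<close>])
  moreover have "?G (\<kappa> *\<^sub>R R x - x) = \<kappa> *\<^sub>R ?G (R x) - ?G x"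
  proof -
    have "?G (\<kappa> *\<^sub>R R x - x) = integral {0..t} (\<lambda>s. \<kappa> *\<^sub>R ((t - s) *\<^sub>R T s (R x)) - (t - s) *\<^sub>R T s x)"
      by (simp add: blinfun.diff_right blinfun.scaleR_right scaleR_diff_right mult.commute)
    also have "\<dots> = integral {0..t} (\<lambda>s. \<kappa> *\<^sub>R ((t - s) *\<^sub>R T s (R x))) - ?G x"
      by (intro integral_diff integrable_continuous_real continuous_intros cont)
    finally show ?thesis
      by (simp only: integral_cmul)
  qed
  ultimately have eq: "\<kappa> *\<^sub>R ?G (R x) - ?G x = ?F (R x) - t *\<^sub>R R x"
    by simp
  have "b = a - c + d" if "a - b = c - d" for a b c d :: 'a
    using that by (simp add: algebra_simps)
  from this[OF eq] have "?G x = \<kappa> *\<^sub>R R (?G x) - R (?F x) + t *\<^sub>R R x"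
    unfolding F G .
  then show ?thesis
    by (simp add: blinfun.diff_right blinfun.add_right blinfun.scaleR_right)
qed

lemma continuous_on_semigroup_integral:
  assumes T: "C0_semigroup T"
  shows "continuous_on {0..b} (\<lambda>t. integral {0..t} (\<lambda>s. T s x))"
  by (intro indefinite_integral_continuous_1 integrable_continuous_real
      C0_semigroup_continuous_on_subset[OF T]) auto

text \<open>The weight depends on the upper limit; expanding \<open>t - s\<close> leaves indefinite
  integrals of fixed integrands.\<close>

lemma continuous_on_semigroup_ramp_integral:
  assumes T: "C0_semigroup T"
  shows "continuous_on {0..b} (\<lambda>t. integral {0..t} (\<lambda>s. (t - s) *\<^sub>R T s x))"
proof -
  note cont = C0_semigroup_continuous_on_subset[OF T, of "{0..t}" for t, simplified]
  have "integral {0..t} (\<lambda>s. (t - s) *\<^sub>R T s x)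
      = t *\<^sub>R integral {0..t} (\<lambda>s. T s x) - integral {0..t} (\<lambda>s. s *\<^sub>R T s x)" for t
  proof -
    have "integral {0..t} (\<lambda>s. (t - s) *\<^sub>R T s x) = integral {0..t} (\<lambda>s. t *\<^sub>R T s x - s *\<^sub>R T s x)"
      by (simp add: scaleR_diff_left)
    also have "\<dots> = integral {0..t} (\<lambda>s. t *\<^sub>R T s x) - integral {0..t} (\<lambda>s. s *\<^sub>R T s x)"
      by (intro integral_diff integrable_continuous_real continuous_intros cont)
    finally show ?thesis
      by simp
  qed
  moreover have "continuous_on {0..b} (\<lambda>t. t *\<^sub>R integral {0..t} (\<lambda>s. T s x)
      - integral {0..t} (\<lambda>s. s *\<^sub>R T s x))"
    by (intro continuous_intros continuous_on_semigroup_integral[OF T] indefinite_integral_continuous_1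
        integrable_continuous_real cont)
  ultimately show ?thesis
    by simp
qed

section \<open>The extrapolation space\<close>

lemma dense_range_sequence:
  fixes j :: "'x \<Rightarrow> 'e::metric_space"
  assumes "closure (range j) = UNIV"
  obtains x where "(\<lambda>n. j (x n)) \<longlonglongrightarrow> a"
proof -
  have "a \<in> closure (range j)"
    by (simp add: assms)
  then have "\<exists>f. (\<forall>n. f n \<in> range j) \<and> f \<longlonglongrightarrow> a"
    by (simp only: closure_sequential)
  then obtain f where f: "(\<forall>n. f n \<in> range j) \<and> f \<longlonglongrightarrow> a" ..
  then have "\<forall>n. \<exists>y. f n = j y"
    by (simp add: image_iff)
  then obtain x where "\<And>n. f n = j (x n)"
    by metis
  then have "f = (\<lambda>n. j (x n))"
    by (rule ext)
  with f show thesis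
    by (intro that[of x]) simp
qed

lemma blinfun_eq_dense:
  fixes P Q :: "'a::real_normed_vector \<Rightarrow>\<^sub>L 'b::real_normed_vector"
  assumes dense: "closure (range j) = UNIV" and eq: "\<And>x. P (j x) = Q (j x)"
  shows "P z = Q z"
proof -
  obtain x where x: "(\<lambda>n. j (x n)) \<longlonglongrightarrow> z"
    using dense_range_sequence[OF dense] by blast
  have "(\<lambda>n. P (j (x n))) \<longlonglongrightarrow> P z" "(\<lambda>n. P (j (x n))) \<longlonglongrightarrow> Q z"
    using blinfun.tendsto[OF tendsto_const x, of P] blinfun.tendsto[OF tendsto_const x, of Q]
    by (simp_all add: eq)
  then show ?thesis
    by (rule LIMSEQ_unique)
qed

text \<open>By the norm inequality \<open>R\<close> factors through \<open>j\<close> as a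
  1-Lipschitz map on a dense subspace. In particular the preimage picked by \<open>SOME\<close> in
  \<open>f\<close> is immaterial.\<close>

lemma dense_range_extension:
  fixes j :: "'x::real_normed_vector \<Rightarrow> 'e::real_normed_vector" and R :: "'x \<Rightarrow>\<^sub>L 'b::banach"
  assumes j: "linear j" and dense: "closure (range j) = UNIV"
    and le: "\<And>x. norm (R x) \<le> norm (j x)"
  obtains J :: "'e \<Rightarrow>\<^sub>L 'b" where "\<And>x. J (j x) = R x"
proof -
  define f where "f a = R (SOME x. j x = a)" for a
  have dist_R: "dist (R x) (R y) \<le> dist (j x) (j y)" for x y
    using le[of "x - y"] by (simp add: dist_norm blinfun.diff_right linear_diff[OF j])
  have f: "f (j x) = R x" for x
  proof -
    have "j (SOME y. j y = j x) = j x"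
      by (rule someI) simp
    then show ?thesis
      using dist_R[of "SOME y. j y = j x" x] by (simp add: f_def)
  qed
  have "uniformly_continuous_on (range j) f"
    unfolding uniformly_continuous_on_def
  proof (intro allI impI)
    fix e :: real assume "0 < e"
    then show "\<exists>d>0. \<forall>a\<in>range j. \<forall>b\<in>range j. dist b a < d \<longrightarrow> dist (f b) (f a) < e"
      by (intro exI[of _ e]) (auto simp: f intro: le_less_trans[OF dist_R])
  qed
  then obtain g where g: "uniformly_continuous_on UNIV g" "\<And>a. a \<in> range j \<Longrightarrow> f a = g a"
    using uniformly_continuous_on_extension_on_closure[of "range j" f] dense by metis
  have gj: "g (j x) = R x" for x
    using g(2)[of "j x"] f by simp
  have lim: "(\<lambda>n. R (x n)) \<longlonglongrightarrow> g a" if "(\<lambda>n. j (x n)) \<longlonglongrightarrow> a" for x a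
  proof -
    have "isCont g a"
      using uniformly_continuous_imp_continuous[OF g(1)] by (simp add: continuous_on_eq_continuous_at)
    from isCont_tendsto_compose[OF this that] show ?thesis
      by (simp add: gj)
  qed
  have "bounded_linear g"
  proof (rule bounded_linear_intro)
    fix a b :: 'e and c :: real
    obtain x y where x: "(\<lambda>n. j (x n)) \<longlonglongrightarrow> a" and y: "(\<lambda>n. j (y n)) \<longlonglongrightarrow> b"
      using dense_range_sequence[OF dense] by metis
    have "(\<lambda>n. j (x n + y n)) \<longlonglongrightarrow> a + b"
      using tendsto_add[OF x y] by (simp add: linear_add[OF j])
    from lim[OF this] tendsto_add[OF lim[OF x] lim[OF y]] show "g (a + b) = g a + g b"
      by (intro LIMSEQ_unique[of "\<lambda>n. R (x n + y n)"]) (simp_all add: blinfun.add_right)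
    have "(\<lambda>n. j (c *\<^sub>R x n)) \<longlonglongrightarrow> c *\<^sub>R a"
      using tendsto_scaleR[OF tendsto_const x] by (simp add: linear_scale[OF j])
    from lim[OF this] tendsto_scaleR[OF tendsto_const lim[OF x]] show "g (c *\<^sub>R a) = c *\<^sub>R g a"
      by (intro LIMSEQ_unique[of "\<lambda>n. R (c *\<^sub>R x n)"]) (simp_all add: blinfun.scaleR_right)
    have "norm (g a) \<le> norm a"
      using tendsto_norm[OF lim[OF x]] tendsto_norm[OF x] le by (intro LIMSEQ_le) auto
    then show "norm (g a) \<le> norm a * 1"
      by simp
  qed
  then show thesis
    by (intro that[of "Blinfun g"]) (simp add: bounded_linear_Blinfun_apply gj)
qed

section \<open>The extended semigroup and resolvents with values in X\<close>

locale extrapolated_semigroup =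
  fixes T :: "real \<Rightarrow> 'x::banach_lattice \<Rightarrow>\<^sub>L 'x" and \<mu> :: real
    and j :: "'x \<Rightarrow> 'e::banach" and S :: "real \<Rightarrow> 'e \<Rightarrow>\<^sub>L 'e"
  assumes T: "C0_semigroup T"
    and extrapolation: "extrapolation_space (generator T) \<mu> j"
    and extends: "extends_semigroup j T S"
begin

lemma S: "C0_semigroup S" and S_j: "0 \<le> t \<Longrightarrow> S t (j x) = j (T t x)"
  using extends by (auto simp: extends_semigroup_def)

lemma linear_j: "linear j" and dense_j: "closure (range j) = UNIV"
  and norm_j: "norm (j x) = norm (resolvent \<mu> (generator T) x)"
  using extrapolation by (auto simp: extrapolation_space_def)

lemma resolvent_T: "is_resolvent \<mu> (generator T) (resolvent \<mu> (generator T))"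
  using extrapolation by (auto simp: extrapolation_space_def resolvent_set_def resolvent_eq)

lemma bounded_linear_j: "bounded_linear j"
proof -
  have "norm (j x) \<le> norm x * norm (resolvent \<mu> (generator T))" for x
    unfolding norm_j using norm_blinfun[of "resolvent \<mu> (generator T)" x] by (simp add: mult.commute)
  then show ?thesis
    by (intro bounded_linear_intro[of j]) (auto simp: linear_add linear_scale linear_j)
qed

definition jb where "jb = Blinfun j"

lemma jb_apply [simp]: "blinfun_apply jb x = j x"
  by (simp add: jb_def bounded_linear_Blinfun_apply[OF bounded_linear_j])

text \<open>A resolvent has trivial kernel because the generator is single-valued at 0, and
  \<open>j\<close> has the same kernel as the resolvent.\<close>

lemma inj_j: "inj j"
proof (rule injI)
  fix x y assume "j x = j y"
  then have "resolvent \<mu> (generator T) (x - y) = 0"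
    using norm_j[of "x - y"] by (simp add: linear_diff[OF linear_j])
  then have "(0, - (x - y)) \<in> generator T"
    using is_resolvent_graph[OF resolvent_T, of "x - y"] by simp
  moreover have "(0, 0) \<in> generator T"
    by (simp add: generator_iff)
  ultimately show "x = y"
    using generator_unique by fastforce
qed

lemma resolvent_j:
  assumes "is_resolvent \<kappa> (generator T) R" "is_resolvent \<kappa> (generator S) Q"
  shows "Q (j x) = j (R x)"
  using resolvent_intertwine[OF assms, of jb x] by (simp add: S_j)

text \<open>This is R(\<mu>,A_{-1}) regarded as an operator into X, obtained by extending R(\<mu>,A)
  isometrically along \<open>j\<close>.\<close>

definition J :: "'e \<Rightarrow>\<^sub>L 'x" where
  "J = (SOME J. \<forall>x. blinfun_apply J (j x) = resolvent \<mu> (generator T) x)"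

lemma J_j: "J (j x) = resolvent \<mu> (generator T) x"
proof -
  obtain J' :: "'e \<Rightarrow>\<^sub>L 'x" where "\<And>x. J' (j x) = resolvent \<mu> (generator T) x"
    using dense_range_extension[OF linear_j dense_j, of "resolvent \<mu> (generator T)"] norm_j by auto
  then have "\<forall>x. J (j x) = resolvent \<mu> (generator T) x"
    unfolding J_def by (intro someI[of "\<lambda>J. \<forall>x. blinfun_apply J (j x) = resolvent \<mu> (generator T) x" J']) blast
  then show ?thesis
    by blast
qed

text \<open>All identities between bounded operators on the extrapolation space are checked on the range
  of \<open>j\<close>; a large \<open>\<kappa>\<close> in both resolvent sets turns the graph of the generator into the range of a
  bounded operator.\<close>

lemma is_resolvent_extrapolated: "is_resolvent \<mu> (generator S) (jb o\<^sub>L J)"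
proof -
  have "eventually (\<lambda>\<kappa>. \<exists>R Q. is_resolvent \<kappa> (generator T) R \<and> is_resolvent \<kappa> (generator S) Q) at_top"
    using eventually_resolvent[OF T] eventually_resolvent[OF S] by eventually_elim blast
  then obtain \<kappa> R Q where R: "is_resolvent \<kappa> (generator T) R" and Q: "is_resolvent \<kappa> (generator S) Q"
    by (auto dest: eventually_happens)
  let ?M = "resolvent \<mu> (generator T)"
  \<comment> \<open>The resolvent identity on X in both directions, written so that it can be
    transported to X_{-1} as an equality of bounded operators.\<close>
  have RM: "R (\<kappa> *\<^sub>R ?M x - (\<mu> *\<^sub>R ?M x - x)) = ?M x" for x
    by (rule is_resolvent_left[OF R is_resolvent_graph[OF resolvent_T]])
  have MR: "?M (\<mu> *\<^sub>R R x - (\<kappa> *\<^sub>R R x - x)) = R x" for x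
    by (rule is_resolvent_left[OF resolvent_T is_resolvent_graph[OF R]])
  have graph: "(j (J z), \<mu> *\<^sub>R j (J z) - z) \<in> generator S" for z
  proof -
    have "(Q o\<^sub>L (\<kappa> *\<^sub>R (jb o\<^sub>L J) - (\<mu> *\<^sub>R (jb o\<^sub>L J) - id_blinfun))) z = (jb o\<^sub>L J) z"
    proof (rule blinfun_eq_dense[OF dense_j])
      fix x
      have "Q (j (\<kappa> *\<^sub>R ?M x - (\<mu> *\<^sub>R ?M x - x))) = j (?M x)"
        by (simp only: resolvent_j[OF R Q] RM)
      then show "(Q o\<^sub>L (\<kappa> *\<^sub>R (jb o\<^sub>L J) - (\<mu> *\<^sub>R (jb o\<^sub>L J) - id_blinfun))) (j x) = (jb o\<^sub>L J) (j x)"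
        by (simp add: J_j blinfun.diff_left blinfun.scaleR_left linear_diff[OF linear_j]
            linear_scale[OF linear_j])
    qed
    then have "Q (\<kappa> *\<^sub>R j (J z) - (\<mu> *\<^sub>R j (J z) - z)) = j (J z)"
      by (simp add: blinfun.diff_left blinfun.scaleR_left)
    then show ?thesis
      using is_resolvent_graph[OF Q, of "\<kappa> *\<^sub>R j (J z) - (\<mu> *\<^sub>R j (J z) - z)"] by simp
  qed
  moreover have "j (J (\<mu> *\<^sub>R a - b)) = a" if "(a, b) \<in> generator S" for a b
  proof -
    have "(jb o\<^sub>L J o\<^sub>L (\<mu> *\<^sub>R Q - (\<kappa> *\<^sub>R Q - id_blinfun))) z = Q z" for z
    proof (rule blinfun_eq_dense[OF dense_j])
      fix x
      have "J (j (\<mu> *\<^sub>R R x - (\<kappa> *\<^sub>R R x - x))) = R x"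
        by (simp only: J_j MR)
      then show "(jb o\<^sub>L J o\<^sub>L (\<mu> *\<^sub>R Q - (\<kappa> *\<^sub>R Q - id_blinfun))) (j x) = Q (j x)"
        by (simp add: resolvent_j[OF R Q] blinfun.diff_left blinfun.scaleR_left linear_diff[OF linear_j]
            linear_scale[OF linear_j])
    qed
    from this[of "\<kappa> *\<^sub>R a - b"] is_resolvent_left[OF Q that] show ?thesis
      by (simp add: blinfun.diff_left blinfun.scaleR_left)
  qed
  ultimately show ?thesis
    by (auto simp: is_resolvent_def)
qed

text \<open>The resolvent of the extended generator at \<open>\<kappa>\<close>, as an operator into the original space.\<close>

definition L :: "real \<Rightarrow> 'e \<Rightarrow>\<^sub>L 'x" where
  "L \<kappa> = J o\<^sub>L (id_blinfun + (\<mu> - \<kappa>) *\<^sub>R resolvent \<kappa> (generator S))"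

text \<open>The resolvent identity reads R(\<kappa>) = R(\<mu>)(I + (\<mu> - \<kappa>)R(\<kappa>))
  on X_{-1}; only the outer factor has to be realised in X, and \<open>J\<close> does that.\<close>

lemma j_L:
  assumes Q: "is_resolvent \<kappa> (generator S) Q"
  shows "j (L \<kappa> b) = Q b"
proof -
  have "(jb o\<^sub>L J) b - Q b = (\<kappa> - \<mu>) *\<^sub>R (jb o\<^sub>L J) (Q b)"
    by (rule resolvent_identity[OF is_resolvent_extrapolated Q])
  moreover have "j (L \<kappa> b) = j (J b) + (\<mu> - \<kappa>) *\<^sub>R j (J (Q b))"
    by (simp add: L_def resolvent_eq[OF Q] blinfun.add_left blinfun.add_right blinfun.scaleR_left
        blinfun.scaleR_right linear_add[OF linear_j] linear_scale[OF linear_j])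
  ultimately show ?thesis
    by (simp add: algebra_simps)
qed

lemma L_j:
  assumes R: "is_resolvent \<kappa> (generator T) R" and Q: "is_resolvent \<kappa> (generator S) Q"
  shows "L \<kappa> (j x) = R x"
  using j_L[OF Q, of "j x"] resolvent_j[OF R Q, of x] inj_j by (simp add: inj_eq)

text \<open>On embedded positive elements \<open>L \<kappa>\<close> is the positive operator
  \<open>R\<close>; continuity reaches the closure. This is how positivity of \<open>B\<close>
  becomes an inequality in X.\<close>

lemma L_nonneg:
  assumes R: "is_resolvent \<kappa> (generator T) R" and Q: "is_resolvent \<kappa> (generator S) Q"
    and pos: "\<And>z. 0 \<le> z \<Longrightarrow> 0 \<le> R z" and b: "b \<in> extrapolated_cone j"
  shows "0 \<le> L \<kappa> b"
proof -
  have "closed (L \<kappa> -` {x. 0 \<le> x})"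
    by (intro continuous_closed_vimage[OF closed_nonneg] linear_continuous_at blinfun.bounded_linear_right)
  then have "extrapolated_cone j \<subseteq> L \<kappa> -` {x. 0 \<le> x}"
    unfolding extrapolated_cone_def
    by (intro closure_minimal) (auto simp: L_j[OF R Q] pos)
  with b show ?thesis
    by auto
qed

end

section \<open>The output of a ramp input\<close>

text \<open>Sampling \<open>f\<close> on a grid gives functions with finitely many values, whatever
  the size of the space. Rounding down keeps the sampling points inside the interval, and
  \<open>Suc i\<close> avoids division by zero.\<close>

lemma continuous_on_strongly_measurable:
  fixes f :: "real \<Rightarrow> 'b::banach"
  assumes f: "continuous_on {0..\<tau>} f"
  shows "strongly_measurable (lebesgue_on {0..\<tau>}) f"
proof -
  define g where "g i t = real_of_int \<lfloor>real (Suc i) * t\<rfloor> / real (Suc i)" for i t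
  have simple: "simple_function (lebesgue_on {0..\<tau>}) (g i)" for i
  proof (rule simple_function_borel_measurable)
    show "g i \<in> borel_measurable (lebesgue_on {0..\<tau>})"
      unfolding g_def by (intro measurable_restrict_space1 measurable_completion) measurable
    have "g i ` {0..\<tau>} \<subseteq> (\<lambda>k. real_of_int k / real (Suc i)) ` {0..\<lfloor>real (Suc i) * \<tau>\<rfloor>}"
      unfolding g_def by (auto intro!: imageI floor_mono mult_left_mono)
    then have "finite (g i ` {0..\<tau>})"
      by (rule finite_subset) simp
    then show "finite (g i ` space (lebesgue_on {0..\<tau>}))"
      by simp
  qed
  have in_interval: "g i t \<in> {0..\<tau>}" and close: "t - 1 / real (Suc i) \<le> g i t" "g i t \<le> t"
    if "t \<in> {0..\<tau>}" for i t
  proof -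
    have "real_of_int \<lfloor>real (Suc i) * t\<rfloor> \<le> real (Suc i) * t"
      by (rule of_int_floor_le)
    then show "g i t \<le> t"
      by (simp add: g_def divide_le_eq mult.commute del: of_nat_Suc)
    moreover have "0 \<le> g i t"
      using that by (simp add: g_def)
    ultimately show "g i t \<in> {0..\<tau>}"
      using that by simp
    have "real (Suc i) * t - 1 \<le> real_of_int \<lfloor>real (Suc i) * t\<rfloor>"
      by linarith
    then have "(real (Suc i) * t - 1) / real (Suc i) \<le> g i t"
      unfolding g_def by (rule divide_right_mono) simp
    then show "t - 1 / real (Suc i) \<le> g i t"
      by (simp add: diff_divide_distrib del: of_nat_Suc)
  qed
  have "(\<lambda>i. f (g i t)) \<longlonglongrightarrow> f t" if t: "t \<in> {0..\<tau>}" for t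
  proof (rule continuous_on_tendsto_compose[OF f _ t])
    have "(\<lambda>i. t - 1 / real (Suc i)) \<longlonglongrightarrow> t - 0"
      by (intro tendsto_diff tendsto_const LIMSEQ_Suc[OF lim_1_over_n])
    then have "(\<lambda>i. t - 1 / real (Suc i)) \<longlonglongrightarrow> t"
      by (simp only: diff_zero)
    then show "(\<lambda>i. g i t) \<longlonglongrightarrow> t"
      by (rule tendsto_sandwich[OF _ _ _ tendsto_const, rotated 2])
        (intro always_eventually allI close t)+
    show "eventually (\<lambda>i. g i t \<in> {0..\<tau>}) sequentially"
      using in_interval[OF t] by simp
  qed
  then have "AE t in lebesgue_on {0..\<tau>}. (\<lambda>i. (f \<circ> g i) t) \<longlonglongrightarrow> f t"
    by (intro AE_I2) simp
  moreover have "simple_function (lebesgue_on {0..\<tau>}) (f \<circ> g i)" for i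
    by (rule simple_function_compose[OF simple])
  ultimately show ?thesis
    unfolding strongly_measurable_def by (intro exI[of _ "\<lambda>i. f \<circ> g i"]) blast
qed

lemma continuous_on_in_Lp:
  fixes f :: "real \<Rightarrow> 'b::banach"
  assumes f: "continuous_on {0..\<tau>} f" and p: "0 \<le> p"
  shows "f \<in> Lp p {0..\<tau>}"
proof -
  have "compact (f ` {0..\<tau>})"
    by (intro compact_continuous_image f compact_Icc)
  then obtain M where M: "\<And>t. t \<in> {0..\<tau>} \<Longrightarrow> norm (f t) \<le> M"
    using compact_imp_bounded by (fastforce simp: bounded_iff)
  have "Lp_norm_pow p {0..\<tau>} f \<le> (\<integral>\<^sup>+t. ennreal (M powr p) \<partial>lebesgue_on {0..\<tau>})"
    unfolding Lp_norm_pow_def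
    by (intro nn_integral_mono ennreal_leI powr_mono2 p M) auto
  also have "\<dots> < \<infinity>"
    by (simp add: emeasure_restrict_space ennreal_mult_less_top emeasure_lborel_Icc_eq)
  finally show ?thesis
    using continuous_on_strongly_measurable[OF f] by (simp add: Lp_def)
qed

lemma ramp_in_W1p_0:
  assumes "0 \<le> p"
  shows "(\<lambda>s. s *\<^sub>R u) \<in> W1p_0 p \<tau>"
proof -
  have "(\<lambda>_. u) \<in> Lp p {0..\<tau>}"
    by (intro continuous_on_in_Lp assms continuous_on_const)
  moreover have "t *\<^sub>R u = 0 *\<^sub>R u + integral {0..t} (\<lambda>_. u)" if "t \<in> {0..\<tau>}" for t
    using that by simp
  ultimately show ?thesis
    unfolding W1p_0_def W1p_def by (auto intro!: bexI[of _ "\<lambda>_. u"])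
qed

lemma Lp_tendsto_const: "Lp_tendsto p S (\<lambda>_. f) f"
  by (simp add: Lp_tendsto_def Lp_norm_pow_def)

text \<open>The interval \<open>{0<..<d}\<close> is not a null set. This supplies an early time at
  which the output can be evaluated.\<close>

lemma AE_lebesgue_on_halfline_obtain:
  fixes d :: real
  assumes AE: "AE t in lebesgue_on {0..}. P t" and "0 < d"
  obtains t where "0 < t" "t < d" "P t"
proof (rule ccontr)
  assume no: "\<not> thesis"
  have "{0::real..} \<in> sets lebesgue"
    by (intro sets_completionI_sets) (simp add: borel_closed)
  then have "AE t in lebesgue. t \<in> {0..} \<longrightarrow> P t"
    using AE AE_restrict_space_iff[of "{0..}" lebesgue P] by simp
  then have "AE t in lebesgue. t \<notin> {0<..<d}"
    by eventually_elim (use no that in force)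
  then have "emeasure lebesgue {0<..<d} = 0"
    by (subst (asm) AE_iff_measurable[of "{0<..<d}"]) auto
  then show False
    using \<open>0 < d\<close> by simp
qed

section \<open>The output operator on Z and the state under a ramp input\<close>

locale extrapolated_system = extrapolated_semigroup T \<mu> j S
  for T :: "real \<Rightarrow> 'x::banach_lattice \<Rightarrow>\<^sub>L 'x" and \<mu> :: real
    and j :: "'x \<Rightarrow> 'e::banach" and S :: "real \<Rightarrow> 'e \<Rightarrow>\<^sub>L 'e" +
  fixes B :: "'u::banach_lattice \<Rightarrow>\<^sub>L 'e" and \<Gamma> :: "'e \<Rightarrow> 'y::banach_lattice" and D\<^sub>\<Sigma> :: "'u \<Rightarrow>\<^sub>L 'y"
  assumes \<Gamma>: "bounded_linear_on_Z \<mu> (generator T) j (generator S) B \<Gamma>"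
begin

abbreviation Z where "Z \<equiv> Z_space \<mu> (generator T) j (generator S) B"
abbreviation H where "H \<equiv> transfer_function (generator S) B \<Gamma> D\<^sub>\<Sigma>"

lemma resolvent_S: "resolvent \<mu> (generator S) z = j (J z)"
  by (simp add: resolvent_eq[OF is_resolvent_extrapolated])

lemma Z_memI: "(x, y) \<in> generator T \<Longrightarrow> j x + j (J (B u)) \<in> Z"
  unfolding Z_space_def resolvent_S by (blast intro: DomainI)

lemma Z_j: "(x, y) \<in> generator T \<Longrightarrow> j x \<in> Z"
  using Z_memI[of x y 0] by (simp add: linear_0[OF linear_j])

lemma Z_scaleR:
  assumes "z \<in> Z"
  shows "c *\<^sub>R z \<in> Z"
proof -
  obtain x y u where z: "z = j x + j (J (B u))" "(x, y) \<in> generator T"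
    using assms by (auto simp: Z_space_def resolvent_S)
  then show ?thesis
    using Z_memI[OF generator_scaleR[OF z(2)], of c "c *\<^sub>R u"]
    by (simp add: linear_scale[OF linear_j] blinfun.scaleR_right scaleR_add_right)
qed

lemma \<Gamma>_add: "z \<in> Z \<Longrightarrow> w \<in> Z \<Longrightarrow> \<Gamma> (z + w) = \<Gamma> z + \<Gamma> w"
  and \<Gamma>_scaleR: "z \<in> Z \<Longrightarrow> \<Gamma> (c *\<^sub>R z) = c *\<^sub>R \<Gamma> z"
  using \<Gamma> by (auto simp: bounded_linear_on_Z_def)

lemma \<Gamma>_diff: "z \<in> Z \<Longrightarrow> w \<in> Z \<Longrightarrow> \<Gamma> (z - w) = \<Gamma> z - \<Gamma> w"
  using \<Gamma>_add[of z "(- 1) *\<^sub>R w"] Z_scaleR[of w "- 1"] \<Gamma>_scaleR[of w "- 1"] by simp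

text \<open>Every decomposition of a vector of Z bounds the infimum in the norm of Z from above, so
  \<open>\<Gamma>\<close> can be estimated through whichever decomposition is at hand. The absolute
  value of \<open>K\<close> is taken because its sign is unknown.\<close>

lemma \<Gamma>_bound:
  obtains K where "0 \<le> K"
    and "\<And>x y u. (x, y) \<in> generator T \<Longrightarrow>
      norm (\<Gamma> (j x + j (J (B u)))) \<le> K * (norm (\<mu> *\<^sub>R x - y) + norm u)"
proof -
  obtain K where K: "\<And>z. z \<in> Z \<Longrightarrow> norm (\<Gamma> z) \<le> K * Z_norm \<mu> (generator T) j (generator S) B z"
    using \<Gamma> unfolding bounded_linear_on_Z_def by blast
  have "norm (\<Gamma> (j x + j (J (B u)))) \<le> \<bar>K\<bar> * (norm (\<mu> *\<^sub>R x - y) + norm u)"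
    if xy: "(x, y) \<in> generator T" for x y u
  proof -
    define z where "z = j x + j (J (B u))"
    define N where "N = {(norm (\<mu> *\<^sub>R x - y))\<^sup>2 + (norm u)\<^sup>2 | x y u.
      (x, y) \<in> generator T \<and> z = j x + resolvent \<mu> (generator S) (B u)}"
    have Zn: "Z_norm \<mu> (generator T) j (generator S) B z = sqrt (Inf N)"
      by (simp add: Z_norm_def N_def)
    have mem: "(norm (\<mu> *\<^sub>R x - y))\<^sup>2 + (norm u)\<^sup>2 \<in> N"
      unfolding N_def resolvent_S z_def using xy by blast
    have pos: "0 \<le> a" if "a \<in> N" for a
      using that by (auto simp: N_def)
    have "0 \<le> Inf N"
      using mem pos by (intro cInf_greatest) auto
    have "Inf N \<le> (norm (\<mu> *\<^sub>R x - y))\<^sup>2 + (norm u)\<^sup>2"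
      using mem pos by (intro cInf_lower bdd_belowI) auto
    then have "sqrt (Inf N) \<le> sqrt ((norm (\<mu> *\<^sub>R x - y))\<^sup>2 + (norm u)\<^sup>2)"
      by (rule real_sqrt_le_mono)
    also have "\<dots> \<le> norm (\<mu> *\<^sub>R x - y) + norm u"
      by (rule sqrt_sum_squares_le_sum) auto
    finally have le: "sqrt (Inf N) \<le> norm (\<mu> *\<^sub>R x - y) + norm u" .
    have "norm (\<Gamma> z) \<le> K * sqrt (Inf N)"
      using K[OF Z_memI[OF xy, of u, folded z_def]] by (simp add: Zn)
    also have "\<dots> \<le> \<bar>K\<bar> * (norm (\<mu> *\<^sub>R x - y) + norm u)"
      using le \<open>0 \<le> Inf N\<close> by (intro mult_mono) auto
    finally show ?thesis
      by (simp add: z_def)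
  qed
  then show thesis
    by (intro that[of "\<bar>K\<bar>"]) auto
qed

text \<open>The operator is CR(\<kappa>,A). It is bounded on X because the X_1 norm of
  \<open>R x\<close>, formed with \<open>\<mu>\<close>, is the norm of
  \<open>((\<mu> - \<kappa>) *\<^sub>R R + id_blinfun) x\<close>.\<close>

lemma \<Gamma>_resolvent_blinfun:
  assumes R: "is_resolvent \<kappa> (generator T) R"
  obtains CR :: "'x \<Rightarrow>\<^sub>L 'y" where "\<And>x. CR x = \<Gamma> (j (R x))"
proof -
  obtain K where K: "0 \<le> K" "\<And>x y u. (x, y) \<in> generator T \<Longrightarrow>
      norm (\<Gamma> (j x + j (J (B u)))) \<le> K * (norm (\<mu> *\<^sub>R x - y) + norm u)"
    using \<Gamma>_bound by blast
  have mem: "j (R x) \<in> Z" for x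
    by (rule Z_j[OF is_resolvent_graph[OF R]])
  have "bounded_linear (\<lambda>x. \<Gamma> (j (R x)))"
  proof (rule bounded_linear_intro)
    fix x y :: 'x and c :: real
    show "\<Gamma> (j (R (x + y))) = \<Gamma> (j (R x)) + \<Gamma> (j (R y))"
      by (simp add: blinfun.add_right linear_add[OF linear_j] \<Gamma>_add mem)
    show "\<Gamma> (j (R (c *\<^sub>R x))) = c *\<^sub>R \<Gamma> (j (R x))"
      by (simp add: blinfun.scaleR_right linear_scale[OF linear_j] \<Gamma>_scaleR mem)
    have "norm (\<Gamma> (j (R x))) \<le> K * norm (\<mu> *\<^sub>R R x - (\<kappa> *\<^sub>R R x - x))"
      using K(2)[OF is_resolvent_graph[OF R], of x 0] by (simp add: linear_0[OF linear_j])
    also have "\<mu> *\<^sub>R R x - (\<kappa> *\<^sub>R R x - x) = ((\<mu> - \<kappa>) *\<^sub>R R + id_blinfun) x"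
      by (simp add: blinfun.add_left blinfun.diff_left blinfun.scaleR_left scaleR_diff_left)
    also have "K * norm (((\<mu> - \<kappa>) *\<^sub>R R + id_blinfun) x) \<le> K * (norm ((\<mu> - \<kappa>) *\<^sub>R R + id_blinfun) * norm x)"
      by (intro mult_left_mono norm_blinfun K)
    finally show "norm (\<Gamma> (j (R x))) \<le> norm x * (K * norm ((\<mu> - \<kappa>) *\<^sub>R R + id_blinfun))"
      by (simp add: mult_ac)
  qed
  then show thesis
    by (intro that[of "Blinfun (\<lambda>x. \<Gamma> (j (R x)))"]) (rule bounded_linear_Blinfun_apply[THEN fun_cong])
qed

text \<open>Z is defined with the fixed \<open>\<mu>\<close>; this form, with \<open>b\<close> in
  the range of \<open>B\<close>, shows that the resolvent at any other point also maps into
  Z.\<close>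

lemma resolvent_S_decomposition:
  assumes Q: "is_resolvent \<kappa> (generator S) Q"
  shows "Q b = j ((\<mu> - \<kappa>) *\<^sub>R resolvent \<mu> (generator T) (L \<kappa> b)) + j (J b)"
proof -
  have "(jb o\<^sub>L J) b - Q b = (\<kappa> - \<mu>) *\<^sub>R (jb o\<^sub>L J) (Q b)"
    by (rule resolvent_identity[OF is_resolvent_extrapolated Q])
  moreover have "J (Q b) = resolvent \<mu> (generator T) (L \<kappa> b)"
    unfolding j_L[OF Q, symmetric] by (rule J_j)
  ultimately show ?thesis
    by (simp add: linear_scale[OF linear_j] linear_diff[OF linear_j] algebra_simps)
qed

lemma Z_resolvent:
  assumes Q: "is_resolvent \<kappa> (generator S) Q"
  shows "Q (B u) \<in> Z"
  unfolding resolvent_S_decomposition[OF Q]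
  by (rule Z_memI[OF generator_scaleR[OF is_resolvent_graph[OF resolvent_T]]])

lemma H_eq: "is_resolvent \<kappa> (generator S) Q \<Longrightarrow> H \<kappa> u = \<Gamma> (Q (B u)) + D\<^sub>\<Sigma> u"
  by (simp add: transfer_function_def resolvent_eq)

lemma H_blinfun:
  assumes Q: "is_resolvent \<kappa> (generator S) Q"
  obtains H' :: "'u \<Rightarrow>\<^sub>L 'y" where "\<And>u. H' u = H \<kappa> u"
proof -
  obtain K where K: "0 \<le> K" "\<And>x y u. (x, y) \<in> generator T \<Longrightarrow>
      norm (\<Gamma> (j x + j (J (B u)))) \<le> K * (norm (\<mu> *\<^sub>R x - y) + norm u)"
    using \<Gamma>_bound by blast
  note mem = Z_resolvent[OF Q]
  have "bounded_linear (\<lambda>u. \<Gamma> (Q (B u)))"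
  proof (rule bounded_linear_intro)
    fix u v :: 'u and c :: real
    show "\<Gamma> (Q (B (u + v))) = \<Gamma> (Q (B u)) + \<Gamma> (Q (B v))"
      by (simp add: blinfun.add_right \<Gamma>_add mem)
    show "\<Gamma> (Q (B (c *\<^sub>R u))) = c *\<^sub>R \<Gamma> (Q (B u))"
      by (simp add: blinfun.scaleR_right \<Gamma>_scaleR mem)
    let ?l = "L \<kappa> (B u)" and ?M = "resolvent \<mu> (generator T)"
    have "norm (\<Gamma> (Q (B u)))
        \<le> K * (norm (\<mu> *\<^sub>R ((\<mu> - \<kappa>) *\<^sub>R ?M ?l) - (\<mu> - \<kappa>) *\<^sub>R (\<mu> *\<^sub>R ?M ?l - ?l)) + norm u)"
      unfolding resolvent_S_decomposition[OF Q]
      by (rule K(2)[OF generator_scaleR[OF is_resolvent_graph[OF resolvent_T]]])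
    also have "\<mu> *\<^sub>R ((\<mu> - \<kappa>) *\<^sub>R ?M ?l) - (\<mu> - \<kappa>) *\<^sub>R (\<mu> *\<^sub>R ?M ?l - ?l)
        = ((\<mu> - \<kappa>) *\<^sub>R (L \<kappa> o\<^sub>L B)) u"
      by (simp add: blinfun.scaleR_left scaleR_diff_right mult.commute)
    also have "K * (norm (((\<mu> - \<kappa>) *\<^sub>R (L \<kappa> o\<^sub>L B)) u) + norm u)
        \<le> K * (norm ((\<mu> - \<kappa>) *\<^sub>R (L \<kappa> o\<^sub>L B)) * norm u + norm u)"
      by (intro mult_left_mono add_right_mono norm_blinfun K)
    finally show "norm (\<Gamma> (Q (B u))) \<le> norm u * (K * (norm ((\<mu> - \<kappa>) *\<^sub>R (L \<kappa> o\<^sub>L B)) + 1))"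
      by (simp add: algebra_simps)
  qed
  then have "blinfun_apply (Blinfun (\<lambda>u. \<Gamma> (Q (B u)))) = (\<lambda>u. \<Gamma> (Q (B u)))"
    by (rule bounded_linear_Blinfun_apply)
  then show thesis
    by (intro that[of "Blinfun (\<lambda>u. \<Gamma> (Q (B u))) + D\<^sub>\<Sigma>"]) (simp add: blinfun.add_left H_eq[OF Q])
qed

lemma L_semigroup:
  assumes Q: "is_resolvent \<kappa> (generator S) Q" and "0 \<le> t"
  shows "L \<kappa> (S t b) = T t (L \<kappa> b)"
proof -
  have "j (L \<kappa> (S t b)) = j (T t (L \<kappa> b))"
    using \<open>0 \<le> t\<close> by (simp add: j_L[OF Q] resolvent_commute[OF S Q] flip: S_j)
  then show ?thesis
    using inj_j by (simp add: inj_eq)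
qed

text \<open>All contributions except \<open>t *\<^sub>R Q (B u)\<close> are brought into X by moving
  \<open>L \<kappa>\<close>, which intertwines \<open>S\<close> and \<open>T\<close>, under the
  integrals.\<close>

lemma input_map_ramp:
  fixes u :: 'u
  assumes Q: "is_resolvent \<kappa> (generator S) Q" and "0 \<le> t"
  defines "x \<equiv> L \<kappa> (B u)"
  shows "input_map S B t (\<lambda>s. s *\<^sub>R u) = t *\<^sub>R Q (B u)
    + j (\<kappa> *\<^sub>R integral {0..t} (\<lambda>s. (t - s) *\<^sub>R T s x) - integral {0..t} (\<lambda>s. T s x))"
proof -
  let ?b = "B u"
  let ?F = "integral {0..t} (\<lambda>s. S s ?b)" and ?G = "integral {0..t} (\<lambda>s. (t - s) *\<^sub>R S s ?b)"
  note cont = C0_semigroup_continuous_on_subset[OF S, of "{0..t}", simplified]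
  have cont_G: "continuous_on {0..t} (\<lambda>s. (t - s) *\<^sub>R S s ?b)"
    by (intro continuous_intros cont)
  \<comment> \<open>Writing \<open>s\<close> as \<open>t - (t - s)\<close> exhibits the integrand as
    the reflection of \<open>\<lambda>s. (t - s) *\<^sub>R S s ?b\<close>.\<close>
  have "input_map S B t (\<lambda>s. s *\<^sub>R u) = integral {0..t} (\<lambda>s. (t - (t - s)) *\<^sub>R S (t - s) ?b)"
    by (simp add: input_map_def blinfun.scaleR_right)
  also have "\<dots> = ?G"
    by (rule integral_reflect_continuous[where f = "\<lambda>s. (t - s) *\<^sub>R S s ?b"])
      (intro continuous_intros C0_semigroup_continuous_on[OF S] \<open>0 \<le> t\<close>)+
  also have "\<dots> = Q (\<kappa> *\<^sub>R ?G - ?F + t *\<^sub>R ?b)"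
    by (rule resolvent_semigroup_ramp_integral[OF S Q \<open>0 \<le> t\<close>])
  also have "\<dots> = t *\<^sub>R Q ?b + j (\<kappa> *\<^sub>R L \<kappa> ?G - L \<kappa> ?F)"
    by (simp add: blinfun.add_right blinfun.diff_right blinfun.scaleR_right linear_diff[OF linear_j]
        linear_scale[OF linear_j] j_L[OF Q])
  also have "L \<kappa> ?F = integral {0..t} (\<lambda>s. T s x)"
    unfolding blinfun_integral[OF cont] x_def by (intro integral_cong) (simp add: L_semigroup[OF Q])
  also have "L \<kappa> ?G = integral {0..t} (\<lambda>s. (t - s) *\<^sub>R T s x)"
    unfolding blinfun_integral[OF cont_G] x_def
    by (intro integral_cong) (simp add: L_semigroup[OF Q] blinfun.scaleR_right)
  finally show ?thesis .
qed

end

section \<open>Monotonicity of the transfer function\<close>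

locale positive_extrapolated_system = extrapolated_system T \<mu> j S B \<Gamma> D\<^sub>\<Sigma>
  for T :: "real \<Rightarrow> 'x::banach_lattice \<Rightarrow>\<^sub>L 'x" and \<mu> :: real
    and j :: "'x \<Rightarrow> 'e::banach" and S :: "real \<Rightarrow> 'e \<Rightarrow>\<^sub>L 'e"
    and B :: "'u::banach_lattice \<Rightarrow>\<^sub>L 'e" and \<Gamma> :: "'e \<Rightarrow> 'y::banach_lattice"
    and D\<^sub>\<Sigma> :: "'u \<Rightarrow>\<^sub>L 'y" +
  assumes T_nonneg: "0 \<le> t \<Longrightarrow> 0 \<le> x \<Longrightarrow> 0 \<le> T t x"
    and B_nonneg: "0 \<le> u \<Longrightarrow> B u \<in> extrapolated_cone j"
    and C_nonneg: "(x, y) \<in> generator T \<Longrightarrow> 0 \<le> x \<Longrightarrow> 0 \<le> \<Gamma> (j x)"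
begin

definition positive_resolvents where
  "positive_resolvents \<kappa> R Q \<longleftrightarrow> is_resolvent \<kappa> (generator T) R \<and> is_resolvent \<kappa> (generator S) Q \<and>
     (\<forall>z\<ge>0. 0 \<le> R z)"

lemma eventually_positive_resolvents: "eventually (\<lambda>\<kappa>. \<exists>R Q. positive_resolvents \<kappa> R Q) at_top"
proof -
  have "eventually (\<lambda>\<kappa>. \<exists>R. is_resolvent \<kappa> (generator T) R \<and> (\<forall>z\<ge>0. 0 \<le> R z)) at_top"
    by (rule eventually_positive_resolvent[OF T T_nonneg])
  then show ?thesis
    using eventually_resolvent[OF S] unfolding positive_resolvents_def by eventually_elim blast
qed

lemma positive_resolventsD:
  assumes "positive_resolvents \<kappa> R Q"
  shows "is_resolvent \<kappa> (generator T) R" "is_resolvent \<kappa> (generator S) Q" "0 \<le> z \<Longrightarrow> 0 \<le> R z"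
  using assms by (auto simp: positive_resolvents_def)

lemma L_B_nonneg: "positive_resolvents \<kappa> R Q \<Longrightarrow> 0 \<le> u \<Longrightarrow> 0 \<le> L \<kappa> (B u)"
  by (rule L_nonneg) (auto dest: positive_resolventsD B_nonneg)

text \<open>The difference is (\<nu> - \<kappa>) C R(\<kappa>,A) R(\<nu>,A_{-1})Bu. The inner
  resolvent is replaced by \<open>L \<nu>\<close>, which puts \<open>B u\<close> into the positive
  cone of X; the outer one then lands in the domain, where \<open>C\<close> is positive.\<close>

lemma H_decreasing:
  assumes \<kappa>: "positive_resolvents \<kappa> R Q" and \<nu>: "positive_resolvents \<nu> R' Q'"
    and "\<kappa> \<le> \<nu>" "0 \<le> u"
  shows "H \<nu> u \<le> H \<kappa> u"
proof -
  note R = positive_resolventsD(1)[OF \<kappa>] and Q = positive_resolventsD(2)[OF \<kappa>]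
    and Q' = positive_resolventsD(2)[OF \<nu>]
  let ?x = "R (L \<nu> (B u))"
  have "Q (B u) - Q' (B u) = (\<nu> - \<kappa>) *\<^sub>R j ?x"
    using resolvent_identity[OF Q Q', of "B u"] by (simp add: resolvent_j[OF R Q] flip: j_L[OF Q'])
  moreover have "\<Gamma> (Q (B u) - Q' (B u)) = H \<kappa> u - H \<nu> u"
    by (simp add: \<Gamma>_diff Z_resolvent[OF Q] Z_resolvent[OF Q'] H_eq[OF Q] H_eq[OF Q'])
  ultimately have "H \<kappa> u - H \<nu> u = (\<nu> - \<kappa>) *\<^sub>R \<Gamma> (j ?x)"
    by (simp add: \<Gamma>_scaleR[OF Z_j[OF is_resolvent_graph[OF R]]])
  moreover have "0 \<le> \<Gamma> (j ?x)"
    by (intro C_nonneg[OF is_resolvent_graph[OF R]] positive_resolventsD(3)[OF \<kappa>]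
        L_B_nonneg[OF \<nu>] \<open>0 \<le> u\<close>)
  ultimately have "0 \<le> H \<kappa> u - H \<nu> u"
    using \<open>\<kappa> \<le> \<nu>\<close> by (simp only: scaleR_nonneg_nonneg diff_ge_0_iff_ge)
  then show ?thesis
    by simp
qed

lemma positive_resolvents_beyond:
  obtains \<kappa> where "0 < \<kappa>" "\<And>\<nu>. \<kappa> \<le> \<nu> \<Longrightarrow> \<exists>R Q. positive_resolvents \<nu> R Q"
proof -
  obtain a where a: "\<And>\<nu>. a \<le> \<nu> \<Longrightarrow> \<exists>R Q. positive_resolvents \<nu> R Q"
    using eventually_positive_resolvents by (auto simp: eventually_at_top_linorder)
  show thesis
    by (rule that[of "max a 1"]) (use a in auto)
qed

lemma H_linear:
  assumes "positive_resolvents \<kappa> R Q"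
  shows "H \<kappa> (u + v) = H \<kappa> u + H \<kappa> v" "H \<kappa> (c *\<^sub>R u) = c *\<^sub>R H \<kappa> u" "H \<kappa> (u - v) = H \<kappa> u - H \<kappa> v"
proof -
  obtain H' :: "'u \<Rightarrow>\<^sub>L 'y" where "\<And>u. H' u = H \<kappa> u"
    using H_blinfun[OF positive_resolventsD(2)[OF assms]] by blast
  then show "H \<kappa> (u + v) = H \<kappa> u + H \<kappa> v" "H \<kappa> (c *\<^sub>R u) = c *\<^sub>R H \<kappa> u" "H \<kappa> (u - v) = H \<kappa> u - H \<kappa> v"
    by (metis blinfun.add_right, metis blinfun.scaleR_right, metis blinfun.diff_right)
qed

text \<open>Monotonicity is available for positive inputs only, so \<open>u\<close> is split into
  its parts. The limits recombine because \<open>H \<kappa>\<close> is linear for all large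
  \<open>\<kappa>\<close>.\<close>

theorem weakly_imp_strongly_regular:
  assumes weak: "weakly_regular (generator S) B \<Gamma> D\<^sub>\<Sigma>"
  shows "strongly_regular (generator S) B \<Gamma> D\<^sub>\<Sigma>"
  unfolding strongly_regular_def
proof
  fix u :: 'u
  obtain a where a: "\<And>\<nu>. a \<le> \<nu> \<Longrightarrow> \<exists>R Q. positive_resolvents \<nu> R Q"
    using positive_resolvents_beyond by blast
  have conv: "\<exists>l. ((\<lambda>\<kappa>. H \<kappa> v) \<longlongrightarrow> l) at_top" if v: "0 \<le> v" for v
  proof -
    obtain l where "weakly_tendsto (\<lambda>\<kappa>. H \<kappa> v) l at_top"
      using weak by (auto simp: weakly_regular_def)
    moreover have "H s v \<le> H r v" if "a \<le> r" "r \<le> s" for r s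
      using a[of r] a[of s] that H_decreasing[OF _ _ \<open>r \<le> s\<close> v] by auto
    ultimately show ?thesis
      using weakly_tendsto_decreasing_imp_tendsto by blast
  qed
  obtain v w where u: "u = v - w" "0 \<le> v" "0 \<le> w"
    by (rule positive_part_decomposition[of u])
  obtain l m where "((\<lambda>\<kappa>. H \<kappa> v) \<longlongrightarrow> l) at_top" "((\<lambda>\<kappa>. H \<kappa> w) \<longlongrightarrow> m) at_top"
    using conv u by metis
  then have "((\<lambda>\<kappa>. H \<kappa> v - H \<kappa> w) \<longlongrightarrow> l - m) at_top"
    by (rule tendsto_diff)
  moreover have "eventually (\<lambda>\<kappa>. H \<kappa> v - H \<kappa> w = H \<kappa> u) at_top"
    using eventually_positive_resolvents by eventually_elim (auto simp: u H_linear)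
  ultimately have "((\<lambda>\<kappa>. H \<kappa> u) \<longlongrightarrow> l - m) at_top"
    by (rule Lim_transform_eventually)
  then show "\<exists>l. ((\<lambda>\<kappa>. H \<kappa> u) \<longlongrightarrow> l) at_top" ..
qed

text \<open>The input \<open>s u\<close> produces the output \<open>t H(\<kappa>)u + C \<xi>(t)\<close> with
  \<open>\<xi>(t) = \<integral>\<^sub>0\<^sup>t (\<kappa>(t - s) - 1) T(s) R(\<kappa>,A\<^sub>-\<^sub>1)Bu ds\<close>, and \<open>\<xi>(t) \<le> 0\<close> as long as \<open>\<kappa>t \<le> 1\<close>.\<close>

theorem H_nonneg:
  assumes R: "positive_resolvents \<kappa> R Q" and "0 < \<kappa>" and u: "0 \<le> u" and p: "0 \<le> p"
    and io_nonneg: "\<And>u y. io_map_ext p S B \<Gamma> D\<^sub>\<Sigma> u y \<Longrightarrow> AE t in lebesgue_on {0..}. 0 \<le> u t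
      \<Longrightarrow> AE t in lebesgue_on {0..}. 0 \<le> y t"
  shows "0 \<le> H \<kappa> u"
proof -
  note RT = positive_resolventsD(1)[OF R] and Q = positive_resolventsD(2)[OF R]
  define x where "x = L \<kappa> (B u)"
  define F where "F t = integral {0..t} (\<lambda>s. T s x)" for t
  define G where "G t = integral {0..t} (\<lambda>s. (t - s) *\<^sub>R T s x)" for t
  \<comment> \<open>Chosen so that \<xi>(t) is \<open>R (\<eta> t)\<close>: it combines the
    resolvent forms of \<open>G t\<close> and \<open>F t\<close>, and it is continuous in X.\<close>
  define \<eta> where "\<eta> t = \<kappa> *\<^sub>R (\<kappa> *\<^sub>R G t - F t + t *\<^sub>R x) - (\<kappa> *\<^sub>R F t - T t x + x)" for t
  define y where "y = io_map S B \<Gamma> D\<^sub>\<Sigma> (\<lambda>s. s *\<^sub>R u)"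
  obtain CR :: "'x \<Rightarrow>\<^sub>L 'y" where CR: "\<And>x. CR x = \<Gamma> (j (R x))"
    using \<Gamma>_resolvent_blinfun[OF RT] by blast
  have \<xi>: "\<kappa> *\<^sub>R G t - F t = R (\<eta> t)" if "0 \<le> t" for t
  proof -
    have "G t = R (\<kappa> *\<^sub>R G t - F t + t *\<^sub>R x)" "F t = R (\<kappa> *\<^sub>R F t - T t x + x)"
      unfolding F_def G_def
      by (rule resolvent_semigroup_ramp_integral[OF T RT that], rule resolvent_semigroup_integral[OF T RT that])
    then show ?thesis
      by (simp only: \<eta>_def blinfun.diff_right blinfun.scaleR_right)
  qed
  have y: "y t = t *\<^sub>R H \<kappa> u + CR (\<eta> t)" if "0 \<le> t" for t
  proof -
    have "input_map S B t (\<lambda>s. s *\<^sub>R u) = t *\<^sub>R Q (B u) + j (R (\<eta> t))"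
      using input_map_ramp[OF Q that, of u] \<xi>[OF that] by (simp add: x_def F_def G_def)
    then show ?thesis
      using \<Gamma>_add[OF Z_scaleR[OF Z_resolvent[OF Q]] Z_j[OF is_resolvent_graph[OF RT]]]
      by (simp add: y_def io_map_def H_eq[OF Q] CR \<Gamma>_scaleR[OF Z_resolvent[OF Q]]
          blinfun.scaleR_right scaleR_add_right)
  qed
  have "continuous_on {0..\<tau>} \<eta>" for \<tau>
    unfolding \<eta>_def F_def G_def
    by (intro continuous_intros continuous_on_semigroup_integral[OF T]
        continuous_on_semigroup_ramp_integral[OF T] C0_semigroup_continuous_on_subset[OF T]) auto
  then have "continuous_on {0..\<tau>} (\<lambda>t. t *\<^sub>R H \<kappa> u + CR (\<eta> t))" for \<tau>
    by (intro continuous_intros)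
  then have "continuous_on {0..\<tau>} y" for \<tau>
    by (rule continuous_on_eq) (simp add: y)
  \<comment> \<open>The ramp already belongs to \<open>W1p_0\<close>, so the constant sequence
    witnesses the extension; continuity of \<open>y\<close> puts it in
    \<open>Lp_loc\<close>.\<close>
  then have "io_map_ext p S B \<Gamma> D\<^sub>\<Sigma> (\<lambda>s. s *\<^sub>R u) y"
    unfolding io_map_ext_def Lp_loc_def
    by (intro conjI INT_I continuous_on_in_Lp p allI impI exI[of _ "\<lambda>_ s. s *\<^sub>R u"] continuous_intros
        ramp_in_W1p_0 Lp_tendsto_const) (auto simp: y_def intro: Lp_tendsto_const)
  moreover have "AE t in lebesgue_on {0..}. 0 \<le> t *\<^sub>R u"
    using u by (intro AE_I2) (auto intro: scaleR_nonneg_nonneg)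
  ultimately have "AE t in lebesgue_on {0..}. 0 \<le> y t"
    by (rule io_nonneg)
  moreover have "0 < 1 / \<kappa>"
    using \<open>0 < \<kappa>\<close> by simp
  ultimately obtain t where t: "0 < t" "t < 1 / \<kappa>" "0 \<le> y t"
    by (rule AE_lebesgue_on_halfline_obtain)
  note cont = C0_semigroup_continuous_on_subset[OF T, of "{0..t}", simplified]
  have "0 \<le> R (- \<eta> t)"
  proof -
    have R_minus: "R (- \<eta> t) = F t - \<kappa> *\<^sub>R G t"
      by (simp add: blinfun.minus_right flip: \<xi>[OF less_imp_le[OF t(1)]])
    have int: "((\<lambda>s. T s x - \<kappa> *\<^sub>R ((t - s) *\<^sub>R T s x)) has_integral F t - \<kappa> *\<^sub>R G t) {0..t}"
      unfolding F_def G_def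
      by (intro has_integral_diff has_integral_cmul integrable_integral integrable_continuous_real
          continuous_intros cont)
    have nonneg: "0 \<le> T s x - \<kappa> *\<^sub>R ((t - s) *\<^sub>R T s x)" if s: "s \<in> {0..t}" for s
    proof -
      have "\<kappa> * (t - s) \<le> \<kappa> * t"
        using s \<open>0 < \<kappa>\<close> by (intro mult_left_mono) auto
      also have "\<dots> \<le> 1"
        using t \<open>0 < \<kappa>\<close> by (simp add: field_simps)
      finally have "0 \<le> (1 - \<kappa> * (t - s)) *\<^sub>R T s x"
        using s u by (intro scaleR_nonneg_nonneg T_nonneg) (auto simp: x_def intro: L_B_nonneg[OF R])
      also have "\<dots> = T s x - \<kappa> *\<^sub>R ((t - s) *\<^sub>R T s x)"
        by (simp only: scaleR_diff_left[of 1] scaleR_one scaleR_scaleR)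
      finally show ?thesis .
    qed
    show ?thesis
      unfolding R_minus by (rule has_integral_nonneg_lattice[OF int nonneg])
  qed
  then have "0 \<le> CR (- \<eta> t)"
    unfolding CR by (rule C_nonneg[OF is_resolvent_graph[OF RT]])
  \<comment> \<open>The correction has the favourable sign: \<open>CR (- \<eta> t)\<close> is C
    applied to the positive vector -\<xi>(t), and it is added to a nonnegative output.\<close>
  moreover have "t *\<^sub>R H \<kappa> u = y t + CR (- \<eta> t)"
    using y[of t] t by (simp add: blinfun.minus_right)
  ultimately have "0 \<le> t *\<^sub>R H \<kappa> u"
    using t(3) by simp
  then have "0 \<le> (1 / t) *\<^sub>R (t *\<^sub>R H \<kappa> u)"
    using t(1) by (intro scaleR_nonneg_nonneg[of "1 / t"]) simp_all
  also have "(1 / t) *\<^sub>R (t *\<^sub>R H \<kappa> u) = H \<kappa> u"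
    using t(1) by simp
  finally show ?thesis .
qed

text \<open>The limit is bounded by order alone: on the cone \<open>0 \<le> d v \<le> H a v\<close>,
  so the monotone norm is controlled by the bounded operator \<open>H a\<close>. The factor 2 in the
  final bound comes from the positive and the negative part of the input.\<close>

theorem positive_feedthrough_exists:
  assumes strong: "strongly_regular (generator S) B \<Gamma> D\<^sub>\<Sigma>" and p: "0 \<le> p"
    and io_nonneg: "\<And>u y. io_map_ext p S B \<Gamma> D\<^sub>\<Sigma> u y \<Longrightarrow> AE t in lebesgue_on {0..}. 0 \<le> u t
      \<Longrightarrow> AE t in lebesgue_on {0..}. 0 \<le> y t"
  obtains D where "is_feedthrough (generator S) B \<Gamma> D\<^sub>\<Sigma> D" "\<And>u. 0 \<le> u \<Longrightarrow> 0 \<le> D u"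
proof -
  obtain d where d: "\<And>u. ((\<lambda>\<kappa>. H \<kappa> u) \<longlongrightarrow> d u) at_top"
    using strong unfolding strongly_regular_def by metis
  obtain a where a: "0 < a" "\<And>\<nu>. a \<le> \<nu> \<Longrightarrow> \<exists>R Q. positive_resolvents \<nu> R Q"
    using positive_resolvents_beyond by blast
  obtain R Q where RQ: "positive_resolvents a R Q"
    using a by blast
  obtain H' :: "'u \<Rightarrow>\<^sub>L 'y" where H': "\<And>u. H' u = H a u"
    using H_blinfun[OF positive_resolventsD(2)[OF RQ]] by blast
  have d_nonneg: "0 \<le> d u" if "0 \<le> u" for u
  proof (rule nonneg_limit[OF d])
    show "eventually (\<lambda>\<kappa>. 0 \<le> H \<kappa> u) at_top"
      using eventually_ge_at_top[of a]
      by eventually_elim (use a H_nonneg[OF _ _ that p io_nonneg] in force)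
  qed simp
  have d_le: "d u \<le> H a u" if "0 \<le> u" for u
  proof -
    have "0 \<le> H a u - d u"
    proof (rule nonneg_limit[OF tendsto_diff[OF tendsto_const d]])
      show "eventually (\<lambda>\<kappa>. 0 \<le> H a u - H \<kappa> u) at_top"
        using eventually_ge_at_top[of a]
        by eventually_elim (use a H_decreasing[OF RQ _ _ that] in force)
    qed simp
    then show ?thesis
      by simp
  qed
  have add: "d (u + v) = d u + d v" for u v
  proof (rule tendsto_unique[OF _ d])
    have "eventually (\<lambda>\<kappa>. H \<kappa> u + H \<kappa> v = H \<kappa> (u + v)) at_top"
      using eventually_positive_resolvents by eventually_elim (auto simp: H_linear)
    with tendsto_add[OF d d] show "((\<lambda>\<kappa>. H \<kappa> (u + v)) \<longlongrightarrow> d u + d v) at_top"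
      by (rule Lim_transform_eventually)
  qed simp
  have scale: "d (c *\<^sub>R u) = c *\<^sub>R d u" for c u
  proof (rule tendsto_unique[OF _ d])
    have "eventually (\<lambda>\<kappa>. c *\<^sub>R H \<kappa> u = H \<kappa> (c *\<^sub>R u)) at_top"
      using eventually_positive_resolvents by eventually_elim (auto simp: H_linear)
    with tendsto_scaleR[OF tendsto_const d] show "((\<lambda>\<kappa>. H \<kappa> (c *\<^sub>R u)) \<longlongrightarrow> c *\<^sub>R d u) at_top"
      by (rule Lim_transform_eventually)
  qed simp
  have "bounded_linear d"
  proof (rule bounded_linear_intro[OF add scale])
    fix u :: 'u
    obtain v w where u: "u = v - w" "0 \<le> v" "0 \<le> w" and le: "norm v \<le> norm u" "norm w \<le> norm u"
      by (rule positive_part_decomposition[of u])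
    have bound: "norm (d v) \<le> norm H' * norm u" if "0 \<le> v" "norm v \<le> norm u" for v
    proof -
      have "norm (d v) \<le> norm (H' v)"
        unfolding H' by (rule norm_mono_nonneg[OF d_nonneg[OF that(1)] d_le[OF that(1)]])
      also have "\<dots> \<le> norm H' * norm v"
        by (rule norm_blinfun)
      also have "\<dots> \<le> norm H' * norm u"
        using that by (intro mult_left_mono) auto
      finally show ?thesis .
    qed
    have "d u = d v - d w"
      using add[of v "- w"] scale[of "- 1" w] by (simp add: u)
    then have "norm (d u) \<le> norm (d v) + norm (d w)"
      by (simp add: norm_triangle_ineq4)
    also have "\<dots> \<le> norm u * (2 * norm H')"
      using bound[OF u(2) le(1)] bound[OF u(3) le(2)] by (simp add: mult_ac)
    finally show "norm (d u) \<le> norm u * (2 * norm H')" .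
  qed
  then have D: "blinfun_apply (Blinfun d) = d"
    by (rule bounded_linear_Blinfun_apply)
  show thesis
    by (rule that[of "Blinfun d"]) (simp_all add: D d d_nonneg is_feedthrough_def)
qed

end

lemma strongly_imp_weakly_regular:
  "strongly_regular Am B \<Gamma> D\<^sub>\<Sigma> \<Longrightarrow> weakly_regular Am B \<Gamma> D\<^sub>\<Sigma>"
  unfolding strongly_regular_def weakly_regular_def weakly_tendsto_def
  by (metis blinfun.tendsto[OF tendsto_const])

theorem theorem4p1:
  fixes p \<mu> :: real
    and T :: "real \<Rightarrow> 'x::banach_lattice \<Rightarrow>\<^sub>L 'x"
    and A :: "('x \<times> 'x) set"
    and j :: "'x \<Rightarrow> 'e::banach"
    and S :: "real \<Rightarrow> 'e \<Rightarrow>\<^sub>L 'e"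
    and Am :: "('e \<times> 'e) set"
    and B :: "'u::banach_lattice \<Rightarrow>\<^sub>L 'e"
    and C :: "'x \<Rightarrow> 'y::banach_lattice"
    and \<Gamma> :: "'e \<Rightarrow> 'y"
    and D\<^sub>\<Sigma> :: "'u \<Rightarrow>\<^sub>L 'y"
  assumes "1 \<le> p"
    and "C0_semigroup T" and "A = generator T"
    and "extrapolation_space A \<mu> j"
    and "extends_semigroup j T S" and "Am = generator S"
    and "bounded_linear_on_Z \<mu> A j Am B \<Gamma>"
    and "\<And>x. x \<in> Domain A \<Longrightarrow> C x = \<Gamma> (j x)"
    and "positive_well_posed_triplet p T j S A B C \<Gamma> D\<^sub>\<Sigma>"
  shows "((positive_well_posed_triplet p T j S A B C \<Gamma> D\<^sub>\<Sigma> \<and> strongly_regular Am B \<Gamma> D\<^sub>\<Sigma>)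
            \<longleftrightarrow> (positive_well_posed_triplet p T j S A B C \<Gamma> D\<^sub>\<Sigma> \<and> weakly_regular Am B \<Gamma> D\<^sub>\<Sigma>))
       \<and> (weakly_regular Am B \<Gamma> D\<^sub>\<Sigma>
            \<longrightarrow> (\<exists>D. is_feedthrough Am B \<Gamma> D\<^sub>\<Sigma> D \<and> (\<forall>u\<ge>0. 0 \<le> D u)))"
proof -
  have pos: "positive_triplet p T j S A B C \<Gamma> D\<^sub>\<Sigma>"
    using assms(9) by (simp add: positive_well_posed_triplet_def)
  interpret positive_extrapolated_system T \<mu> j S B \<Gamma> D\<^sub>\<Sigma>
  proof
    show "C0_semigroup T" "extrapolation_space (generator T) \<mu> j" "extends_semigroup j T S"
      "bounded_linear_on_Z \<mu> (generator T) j (generator S) B \<Gamma>"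
      using assms by auto
    show "0 \<le> T t x" if "0 \<le> t" "0 \<le> x" for t x
      using pos that by (simp add: positive_triplet_def)
    show "B u \<in> extrapolated_cone j" if "0 \<le> u" for u
      using pos that by (simp add: positive_triplet_def)
    show "0 \<le> \<Gamma> (j x)" if "(x, y) \<in> generator T" "0 \<le> x" for x y
    proof -
      have x: "x \<in> Domain A"
        using that(1) assms(3) by blast
      then have "0 \<le> C x"
        using pos that(2) by (simp add: positive_triplet_def)
      then show ?thesis
        using assms(8)[OF x] by simp
    qed
  qed
  have strong: "strongly_regular Am B \<Gamma> D\<^sub>\<Sigma>" if "weakly_regular Am B \<Gamma> D\<^sub>\<Sigma>"
    using weakly_imp_strongly_regular that assms(6) by simp
  have "\<exists>D. is_feedthrough Am B \<Gamma> D\<^sub>\<Sigma> D \<and> (\<forall>u\<ge>0. 0 \<le> D u)" if weak: "weakly_regular Am B \<Gamma> D\<^sub>\<Sigma>"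
  proof -
    have "AE t in lebesgue_on {0..}. 0 \<le> y t"
      if "io_map_ext p S B \<Gamma> D\<^sub>\<Sigma> u y" "AE t in lebesgue_on {0..}. 0 \<le> u t" for u y
      using pos that unfolding positive_triplet_def by blast
    then obtain D where "is_feedthrough (generator S) B \<Gamma> D\<^sub>\<Sigma> D" "\<And>u. 0 \<le> u \<Longrightarrow> 0 \<le> D u"
      using positive_feedthrough_exists[of p] strong[OF weak] assms(1,6) by auto
    then show ?thesis
      using assms(6) by blast
  qed
  then show ?thesis
    using strong strongly_imp_weakly_regular by blast
qed

end
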